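(* Let $S=\langle n_1,n_2,n_3,n_4\rangle$ be a $4$-generated pseudo symmetric numerical semigroup with defining integers $\alpha_1,\alpha_2,\alpha_3,\alpha_4,\alpha_{21}$. Suppose $n_1$ is the smallest number in $\{n_1,n_2,n_3,n_4\}$. The tangent cone of the monomial curve $C_S$ at the origin is Cohen-Macaulay if and only if all of the following hold: (1) $\alpha_2\le \alpha_{21}+1$, (2) $\alpha_{21}+\alpha_3\le \alpha_1$, (3) $\alpha_4\le \alpha_2+\alpha_3-1$.
   Context: Setting. $n_1,\dots,n_4$ are positive integers with $\gcd(n_1,\dots,n_4)=1$, and $S=\langle n_1,\dots,n_4\rangle=\{u_1n_1+\cdots+u_4n_4 \mid u_i\in\mathbb N\}$ ($0\in\mathbb N$) is the numerical semigroup they generate; $S$ is $4$-generated, i.e. $n_1,\dots,n_4$ is its minimal generating set. The set of pseudo Frobenius numbers is $PF(S)=\{n\in\mathbb Z\setminus S \mid n+s\in S \text{ for all } s\in S\setminus\{0\}\}$, and $g(S)=\max PF(S)$ is the Frobenius number. $S$ is pseudo symmetric if $PF(S)=\{g(S)/2,g(S)\}$. By a theorem of Komeda, for $S$ pseudo symmetric the generators can be labelled so that there are integers $\alpha_i>1$ ($1\le i\le 4$) and $\alpha_{21}$ with $0<\alpha_{21}<\alpha_1$ such that $n_1=\alpha_2\alpha_3(\alpha_4-1)+1$, $n_2=\alpha_{21}\alpha_3\alpha_4+(\alpha_1-\alpha_{21}-1)(\alpha_3-1)+\alpha_3$, $n_3=\alpha_1\alpha_4+(\alpha_1-\alpha_{21}-1)(\alpha_2-1)(\alpha_4-1)-\alpha_4+1$,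 $n_4=\alpha_1\alpha_2(\alpha_3-1)+\alpha_{21}(\alpha_2-1)+\alpha_2$. Such a labelling and such integers (the defining integers of $S$) are fixed. Minimality of the generating set forces $\alpha_1-\alpha_{21}\ge 2$. Let $K$ be a field, $A=K[X_1,\dots,X_4]$, and let $I_S$ be the kernel of $A\to K[t^{n_1},\dots,t^{n_4}]$, $X_i\mapsto t^{n_i}$. $C_S$ is the affine monomial curve parametrized by $X_i=t^{n_i}$, with local ring $R_S=K[[t^{n_1},\dots,t^{n_4}]]$ at the origin and maximal ideal $m$. For nonzero $f\in A$, $f_*$ denotes its homogeneous summand of least total degree (standard grading), and ${I_S}_*$ is the ideal generated by all $f_*$ with $0\neq f\in I_S$. The associated graded ring $gr_m(R_S)$ is isomorphic to $A/{I_S}_*$; the tangent cone of $C_S$ at the origin is Cohen-Macaulay if this ring is Cohen-Macaulay. *)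

theory Defs
  imports
    "HOL-Algebra.Algebraic_Closure_Type"
    "HOL-Computational_Algebra.Polynomial"
    "HOL-Library.Poly_Mapping"
    "HOL-Library.Numeral_Type"
    "HOL-Library.Extended_Nat"
begin

subsection \<open>Numerical semigroups\<close>

definition gen_semigroup :: "('i \<Rightarrow> nat) \<Rightarrow> 'i set \<Rightarrow> nat set" where
  "gen_semigroup n J = {\<Sum>i\<in>J. u i * n i | u :: 'i \<Rightarrow> nat. True}"

text \<open>Minimality also rules out repetitions, so a minimally generating family indexed by a type
  with four elements is a minimal generating set with exactly four elements.\<close>

definition minimal_gens :: "('i::finite \<Rightarrow> nat) \<Rightarrow> bool" where
  "minimal_gens n \<longleftrightarrow> (\<forall>J. J \<subset> UNIV \<longrightarrow> gen_semigroup n J \<noteq> gen_semigroup n UNIV)"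

definition pseudo_frobenius :: "nat set \<Rightarrow> int set" where
  "pseudo_frobenius S = {z. z \<notin> int ` S \<and> (\<forall>s\<in>S - {0}. z + int s \<in> int ` S)}"

definition frobenius :: "nat set \<Rightarrow> int" where
  "frobenius S = Max (pseudo_frobenius S)"

text \<open>The condition \<open>PF(S) = {g(S)/2, g(S)}\<close> forces \<open>g(S)\<close> to be even, since \<open>PF(S)\<close> consists of
  integers. If it holds then \<open>PF(S)\<close> is finite and nonempty, so \<^const>\<open>Max\<close> is meaningful.\<close>

definition pseudo_symmetric :: "nat set \<Rightarrow> bool" where
  "pseudo_symmetric S \<longleftrightarrow>
     even (frobenius S) \<and> pseudo_frobenius S = {frobenius S div 2, frobenius S}"

text \<open>Komeda's parametrization. The index type is \<open>4\<close>, whose elements are \<open>1, 2, 3, 4\<close>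
  (with \<open>4 = 0\<close>). The parameters are integers, so that subtraction is not truncated.\<close>

definition defining_integers ::
    "(4 \<Rightarrow> nat) \<Rightarrow> int \<Rightarrow> int \<Rightarrow> int \<Rightarrow> int \<Rightarrow> int \<Rightarrow> bool" where
  "defining_integers n \<alpha>1 \<alpha>2 \<alpha>3 \<alpha>4 \<alpha>21 \<longleftrightarrow>
     \<alpha>1 > 1 \<and> \<alpha>2 > 1 \<and> \<alpha>3 > 1 \<and> \<alpha>4 > 1 \<and> 0 < \<alpha>21 \<and> \<alpha>21 < \<alpha>1 \<and>
     int (n 1) = \<alpha>2 * \<alpha>3 * (\<alpha>4 - 1) + 1 \<and>
     int (n 2) = \<alpha>21 * \<alpha>3 * \<alpha>4 + (\<alpha>1 - \<alpha>21 - 1) * (\<alpha>3 - 1) + \<alpha>3 \<and>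
     int (n 3) = \<alpha>1 * \<alpha>4 + (\<alpha>1 - \<alpha>21 - 1) * (\<alpha>2 - 1) * (\<alpha>4 - 1) - \<alpha>4 + 1 \<and>
     int (n 4) = \<alpha>1 * \<alpha>2 * (\<alpha>3 - 1) + \<alpha>21 * (\<alpha>2 - 1) + \<alpha>2"

subsection \<open>The ideal of a monomial curve and its tangent cone\<close>

text \<open>Polynomials over \<open>'k\<close> in the variables \<open>X\<^sub>i\<close>, \<open>i :: 'i\<close>: finitely supported maps from exponent
  vectors to coefficients, with the convolution product.\<close>

type_synonym ('i, 'k) mpoly = "('i \<Rightarrow>\<^sub>0 nat) \<Rightarrow>\<^sub>0 'k"

definition curve_map :: "('i::finite \<Rightarrow> nat) \<Rightarrow> ('i, 'k::comm_ring_1) mpoly \<Rightarrow> 'k poly" where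
  "curve_map n f =
     (\<Sum>m\<in>Poly_Mapping.keys f. Polynomial.smult (Poly_Mapping.lookup f m)
        (\<Prod>i\<in>UNIV. Polynomial.monom 1 (n i) ^ Poly_Mapping.lookup m i))"

definition curve_ideal :: "('i::finite \<Rightarrow> nat) \<Rightarrow> ('i, 'k::comm_ring_1) mpoly set" where
  "curve_ideal n = {f. curve_map n f = 0}"

definition total_deg :: "('i::finite \<Rightarrow>\<^sub>0 nat) \<Rightarrow> nat" where
  "total_deg m = (\<Sum>i\<in>UNIV. Poly_Mapping.lookup m i)"

text \<open>The homogeneous summand of least degree; only meaningful for \<open>f \<noteq> 0\<close>.\<close>

definition initial_form :: "('i::finite, 'k::comm_ring_1) mpoly \<Rightarrow> ('i, 'k) mpoly" where
  "initial_form f =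
     (\<Sum>m\<in>{m \<in> Poly_Mapping.keys f. total_deg m = Min (total_deg ` Poly_Mapping.keys f)}.
        Poly_Mapping.single m (Poly_Mapping.lookup f m))"

definition initial_ideal :: "('i::finite, 'k::comm_ring_1) mpoly set \<Rightarrow> ('i, 'k) mpoly set" where
  "initial_ideal I = genideal ring_of_type_algebra {initial_form f | f. f \<in> I \<and> f \<noteq> 0}"

text \<open>For \<open>I\<close> the ideal of a monomial curve through the origin, this is (up to isomorphism) the
  associated graded ring of the local ring of the curve at the origin.\<close>

definition tangent_cone_ring :: "('i::finite, 'k::comm_ring_1) mpoly set \<Rightarrow> ('i, 'k) mpoly set ring"
  where "tangent_cone_ring I = ring_of_type_algebra Quot initial_ideal I"

subsection \<open>Cohen-Macaulay rings\<close>

text \<open>The element \<open>x\<^sub>i\<close> is a nonzerodivisor on \<open>R/(x\<^sub>0, \<dots>, x\<^bsub>i-1\<^esub>)\<close> for every \<open>i\<close>, and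
  \<open>R/(x\<^sub>0, \<dots>, x\<^bsub>r-1\<^esub>)\<close> is not the zero ring.\<close>

definition regular_sequence :: "('a, 'b) ring_scheme \<Rightarrow> 'a list \<Rightarrow> bool" where
  "regular_sequence R xs \<longleftrightarrow>
     set xs \<subseteq> carrier R \<and>
     genideal R (set xs) \<noteq> carrier R \<and>
     (\<forall>i < length xs. \<forall>y \<in> carrier R.
        xs ! i \<otimes>\<^bsub>R\<^esub> y \<in> genideal R (set (take i xs)) \<longrightarrow> y \<in> genideal R (set (take i xs)))"

definition ideal_depth :: "('a, 'b) ring_scheme \<Rightarrow> 'a set \<Rightarrow> enat" where
  "ideal_depth R J = Sup {enat (length xs) | xs. regular_sequence R xs \<and> set xs \<subseteq> J}"

definition prime_height :: "('a, 'b) ring_scheme \<Rightarrow> 'a set \<Rightarrow> enat" where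
  "prime_height R P =
     Sup {enat k | k. \<exists>C :: nat \<Rightarrow> 'a set.
            (\<forall>i\<le>k. primeideal (C i) R) \<and> (\<forall>i<k. C i \<subset> C (Suc i)) \<and> C k = P}"

text \<open>The definition of Eisenbud, Commutative Algebra, Section 18.2, for a Noetherian commutative
  ring \<open>R\<close>: depth and codimension (height) agree at every maximal ideal. Being Noetherian is a
  precondition and not part of the predicate; it holds for all quotients of polynomial rings in
  finitely many variables over a field.\<close>

definition cohen_macaulay :: "('a, 'b) ring_scheme \<Rightarrow> bool" where
  "cohen_macaulay R \<longleftrightarrow> (\<forall>P. maximalideal P R \<longrightarrow> ideal_depth R P = prime_height R P)"

end

theory Submission
  imports Defs "HOL-Analysis.Cartesian_Space"
begin

text \<open>Let \<open>L(s)\<close> be the greatest length of a factorization of \<open>s \<in> S\<close> into generators. The ring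
  \<open>A/I\<^sub>*\<close> has a basis \<open>e\<^sub>s\<close>, \<open>s \<in> S\<close>, with \<open>e\<^sub>s e\<^sub>t = e\<^bsub>s+t\<^esub>\<close> if \<open>L(s + t) = L(s) + L(t)\<close> and
  \<open>e\<^sub>s e\<^sub>t = 0\<close> otherwise (\<open>initial_ideal_eq\<close>). Because \<open>n\<^sub>1\<close> is strictly the least generator, \<open>e\<^sub>s\<close> is nilpotent
  unless \<open>s\<close> is a multiple of \<open>n\<^sub>1\<close>, and \<open>x = e\<^bsub>n 1\<^esub>\<close> generates a polynomial ring. So
  \<open>A/I\<^sub>*\<close> is \<open>K[x]\<close> modulo nilpotents. In such a graded ring all maximal ideals have height 1, and the ring is
  Cohen-Macaulay if and only if \<open>x\<close> is a nonzerodivisor (\<open>cohen_macaulay_iff_param_regular\<close>), which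
  here means \<open>L(s + n\<^sub>1) = L(s) + 1\<close> for all \<open>s \<in> S\<close> (\<open>tangent_cone_cohen_macaulay_iff\<close>).

  Komeda's formulas imply the relations
  \<open>\<alpha>\<^sub>1 n\<^sub>1 = n\<^sub>3 + (\<alpha>\<^sub>4 - 1) n\<^sub>4\<close>, \<open>\<alpha>\<^sub>2 n\<^sub>2 = \<alpha>\<^sub>2\<^sub>1 n\<^sub>1 + n\<^sub>4\<close>, \<open>\<alpha>\<^sub>3 n\<^sub>3 = (\<alpha>\<^sub>1 - \<alpha>\<^sub>2\<^sub>1 - 1) n\<^sub>1 + n\<^sub>2\<close>,
  \<open>\<alpha>\<^sub>4 n\<^sub>4 = n\<^sub>1 + (\<alpha>\<^sub>2 - 1) n\<^sub>2 + (\<alpha>\<^sub>3 - 1) n\<^sub>3\<close> and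
  \<open>n\<^sub>2 + (\<alpha>\<^sub>4 - 1) n\<^sub>4 = (\<alpha>\<^sub>2\<^sub>1 + 1) n\<^sub>1 + (\<alpha>\<^sub>3 - 1) n\<^sub>3\<close>. Used as rewrite rules that produce factors \<open>n\<^sub>1\<close>, they
  bring every factorization into a normal form \<open>k n\<^sub>1 + w\<close>. There are exactly
  \<open>\<alpha>\<^sub>2 \<alpha>\<^sub>3 (\<alpha>\<^sub>4 - 1) + 1 = n\<^sub>1\<close> irreducible \<open>w\<close>, and they represent all residues modulo \<open>n\<^sub>1\<close>, so
  normal forms are unique (\<open>normal_form_unique\<close>). The three inequalities of the theorem say that the second,
  third and fourth rule do not shorten factorizations; for the other two rules this follows.
  Under these conditions the normal form of \<open>s\<close> is a longest factorization, and \<open>L\<close> grows by one when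
  \<open>n\<^sub>1\<close> is added. Conversely, if \<open>L\<close> grows by one, then normal forms are longest, in particular not
  shorter than \<open>\<alpha>\<^sub>2 n\<^sub>2\<close>, \<open>\<alpha>\<^sub>3 n\<^sub>3\<close> and \<open>\<alpha>\<^sub>4 n\<^sub>4\<close>, which gives the inequalities
  (\<open>additive_length_iff_balanced\<close>).\<close>

section \<open>Quotients of a commutative ring given as a type\<close>

lemma type_ring_simps:
  "carrier (ring_of_type_algebra :: 'a::comm_ring_1 ring) = UNIV"
  "x \<otimes>\<^bsub>(ring_of_type_algebra :: 'a ring)\<^esub> y = x * y"
  "x \<oplus>\<^bsub>(ring_of_type_algebra :: 'a ring)\<^esub> y = x + y"
  "\<zero>\<^bsub>(ring_of_type_algebra :: 'a ring)\<^esub> = 0"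
  "\<one>\<^bsub>(ring_of_type_algebra :: 'a ring)\<^esub> = 1"
  by (simp_all add: ring_of_type_algebra_def)

lemma type_ring_ideal_iff:
  fixes T :: "'a::comm_ring_1 set"
  shows "ideal T ring_of_type_algebra \<longleftrightarrow>
    0 \<in> T \<and> (\<forall>a\<in>T. \<forall>b\<in>T. a + b \<in> T) \<and> (\<forall>a\<in>T. \<forall>r. r * a \<in> T)" (is "?L \<longleftrightarrow> ?R")
proof
  assume ?L
  then interpret ideal T "ring_of_type_algebra :: 'a ring" .
  show ?R
    using additive_subgroup.zero_closed[OF additive_subgroup_axioms]
      additive_subgroup.a_closed[OF additive_subgroup_axioms] I_l_closed
    by (auto simp: type_ring_simps)
next
  assume R: ?R
  interpret cring "ring_of_type_algebra :: 'a ring" by (rule cring_from_type_algebra)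
  have inv: "\<ominus>\<^bsub>(ring_of_type_algebra :: 'a ring)\<^esub> a = (- 1) * a" for a :: 'a
    by (rule sum_zero_eq_neg[symmetric]) (auto simp: type_ring_simps)
  show ?L
  proof (rule idealI)
    show "ring (ring_of_type_algebra :: 'a ring)" by (rule ring_axioms)
    show "subgroup T (add_monoid (ring_of_type_algebra :: 'a ring))"
    proof (rule add.subgroupI)
      show "T \<noteq> {}" using R by blast
      show "\<ominus>\<^bsub>(ring_of_type_algebra :: 'a ring)\<^esub> a \<in> T" if "a \<in> T" for a
        using R that unfolding inv by blast
      show "a \<oplus>\<^bsub>(ring_of_type_algebra :: 'a ring)\<^esub> b \<in> T" if "a \<in> T" "b \<in> T" for a b
        using R that by (simp add: type_ring_simps)
    qed (simp add: type_ring_simps)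
    show "r \<otimes>\<^bsub>(ring_of_type_algebra :: 'a ring)\<^esub> a \<in> T" if "a \<in> T" for a r
      using R that by (simp add: type_ring_simps)
    then show "a \<otimes>\<^bsub>(ring_of_type_algebra :: 'a ring)\<^esub> r \<in> T" if "a \<in> T" for a r
      using that by (simp add: type_ring_simps mult.commute[of a r])
  qed
qed

lemma type_ring_idealD:
  fixes T :: "'a::comm_ring_1 set"
  assumes "ideal T ring_of_type_algebra"
  shows "0 \<in> T" "a \<in> T \<Longrightarrow> b \<in> T \<Longrightarrow> a + b \<in> T" "a \<in> T \<Longrightarrow> r * a \<in> T"
    "a \<in> T \<Longrightarrow> b \<in> T \<Longrightarrow> a - b \<in> T"
proof -
  show *: "0 \<in> T" "a \<in> T \<Longrightarrow> b \<in> T \<Longrightarrow> a + b \<in> T" "a \<in> T \<Longrightarrow> r * a \<in> T" for a b r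
    using assms unfolding type_ring_ideal_iff by blast+
  show "a \<in> T \<Longrightarrow> b \<in> T \<Longrightarrow> a - b \<in> T"
    using *(2)[of a "- 1 * b"] *(3)[of b "- 1"] by simp
qed

text \<open>The quotient \<open>Q\<close> of a commutative ring \<open>A\<close> that is given as a type. Elements and ideals of
  \<open>Q\<close> are handled through their preimages in \<open>A\<close>, where the arithmetic of type classes is
  available: an ideal of \<open>Q\<close> is the same as an ideal of \<open>A\<close> containing \<open>J\<close>.\<close>
locale type_ideal =
  fixes J :: "'a::comm_ring_1 set"
  assumes J_ideal: "ideal J ring_of_type_algebra"
begin

abbreviation "A \<equiv> (ring_of_type_algebra :: 'a ring)"
abbreviation "Q \<equiv> A Quot J"
abbreviation "cl a \<equiv> J +>\<^bsub>A\<^esub> a"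

lemma J_zero: "0 \<in> J" and J_add: "a \<in> J \<Longrightarrow> b \<in> J \<Longrightarrow> a + b \<in> J"
  and J_mult: "a \<in> J \<Longrightarrow> r * a \<in> J"
  using J_ideal unfolding type_ring_ideal_iff by blast+

lemma J_minus: "a \<in> J \<Longrightarrow> - a \<in> J"
  using J_mult[of a "-1"] by simp

lemma J_diff: "a \<in> J \<Longrightarrow> b \<in> J \<Longrightarrow> a - b \<in> J"
  using J_add[of a "- b"] J_minus by simp

lemma cring_Q: "cring Q"
  by (rule ideal.quotient_is_cring[OF J_ideal cring_from_type_algebra])

lemma cl_eq_iff: "cl a = cl b \<longleftrightarrow> a - b \<in> J"
proof -
  have cl: "cl a = {h + a | h. h \<in> J}" for a
    by (auto simp: a_r_coset_def r_coset_def type_ring_simps)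
  show ?thesis
  proof
    assume "cl a = cl b"
    moreover have "a \<in> cl a" unfolding cl using J_zero by force
    ultimately obtain h where "h \<in> J" "a = h + b" unfolding cl by blast
    then show "a - b \<in> J" by simp
  next
    assume ab: "a - b \<in> J"
    have "h + a = (h + (a - b)) + b" "h + b = (h - (a - b)) + a" for h by simp_all
    then show "cl a = cl b" unfolding cl using J_add J_diff ab by blast
  qed
qed

lemma carrier_Q: "carrier Q = range cl"
  by (auto simp: FactRing_def A_RCOSETS_def' type_ring_simps)

lemma Q_simps:
  "cl a \<otimes>\<^bsub>Q\<^esub> cl b = cl (a * b)"
  "cl a \<oplus>\<^bsub>Q\<^esub> cl b = cl (a + b)"
  "\<one>\<^bsub>Q\<^esub> = cl 1"
  "\<zero>\<^bsub>Q\<^esub> = cl 0"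
proof -
  note h = ideal.rcos_ring_hom[OF J_ideal]
  show "cl a \<otimes>\<^bsub>Q\<^esub> cl b = cl (a * b)" "cl a \<oplus>\<^bsub>Q\<^esub> cl b = cl (a + b)" "\<one>\<^bsub>Q\<^esub> = cl 1"
    using ring_hom_mult[OF h, of a b] ring_hom_add[OF h, of a b] ring_hom_one[OF h]
    by (simp_all add: type_ring_simps)
  show "\<zero>\<^bsub>Q\<^esub> = cl 0"
    using ring_hom_zero[OF h ring_from_type_algebra cring.axioms(1)[OF cring_Q]]
    by (simp add: type_ring_simps)
qed

lemma ideal_vimage:
  assumes "ideal P Q"
  shows "ideal (cl -` P) A" "J \<subseteq> cl -` P"
proof -
  interpret P: ideal P Q by fact
  have z: "cl 0 \<in> P"
    using additive_subgroup.zero_closed[OF P.additive_subgroup_axioms] by (simp add: Q_simps)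
  show "ideal (cl -` P) A"
    unfolding type_ring_ideal_iff
    using z additive_subgroup.a_closed[OF P.additive_subgroup_axioms] P.I_l_closed
    by (auto simp: Q_simps[symmetric] carrier_Q)
  show "J \<subseteq> cl -` P"
  proof
    fix a assume "a \<in> J"
    then have "cl a = cl 0" by (simp add: cl_eq_iff)
    with z show "a \<in> cl -` P" by simp
  qed
qed

lemma ideal_image:
  assumes T: "ideal T A"
  shows "ideal (cl ` T) Q"
proof -
  interpret cring Q by (rule cring_Q)
  have T0: "0 \<in> T" and T_add: "\<And>a b. a \<in> T \<Longrightarrow> b \<in> T \<Longrightarrow> a + b \<in> T"
    and T_mult: "\<And>a r. a \<in> T \<Longrightarrow> r * a \<in> T"
    using T unfolding type_ring_ideal_iff by blast+
  have inv: "\<ominus>\<^bsub>Q\<^esub> cl a = cl (- 1 * a)" for a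
    by (rule sum_zero_eq_neg[symmetric]) (auto simp: Q_simps carrier_Q)
  show ?thesis
  proof (rule idealI)
    show "subgroup (cl ` T) (add_monoid Q)"
    proof (rule add.subgroupI)
      show "cl ` T \<subseteq> carrier Q" by (auto simp: carrier_Q)
      show "cl ` T \<noteq> {}" using T0 by blast
      show "\<ominus>\<^bsub>Q\<^esub> x \<in> cl ` T" if "x \<in> cl ` T" for x
        using that T_mult[of _ "- 1"] by (auto simp: inv)
      show "x \<oplus>\<^bsub>Q\<^esub> y \<in> cl ` T" if "x \<in> cl ` T" "y \<in> cl ` T" for x y
        using that T_add by (auto simp: Q_simps)
    qed
    show "y \<otimes>\<^bsub>Q\<^esub> x \<in> cl ` T" if "x \<in> cl ` T" "y \<in> carrier Q" for x y
      using that T_mult by (auto simp: Q_simps carrier_Q)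
    show "x \<otimes>\<^bsub>Q\<^esub> y \<in> cl ` T" if "x \<in> cl ` T" "y \<in> carrier Q" for x y
      using that T_mult by (auto simp: Q_simps carrier_Q mult.commute)
  qed (rule ring_axioms)
qed

lemma cl_in_image_iff:
  assumes "ideal T A" "J \<subseteq> T"
  shows "cl a \<in> cl ` T \<longleftrightarrow> a \<in> T"
proof
  assume "cl a \<in> cl ` T"
  then obtain t where "t \<in> T" "a - t \<in> J" by (auto simp: cl_eq_iff)
  then have "(a - t) + t \<in> T" using assms unfolding type_ring_ideal_iff by blast
  then show "a \<in> T" by simp
qed blast

lemma primeideal_vimage:
  assumes "primeideal P Q"
  shows "a * b \<in> cl -` P \<Longrightarrow> a \<in> cl -` P \<or> b \<in> cl -` P" "1 \<notin> cl -` P"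
proof -
  interpret primeideal P Q by fact
  show "a * b \<in> cl -` P \<Longrightarrow> a \<in> cl -` P \<or> b \<in> cl -` P"
    using I_prime[of "cl a" "cl b"] unfolding Q_simps carrier_Q by simp
  show "1 \<notin> cl -` P"
    using one_imp_carrier I_notcarr unfolding Q_simps by (metis vimageD)
qed

lemma primeideal_image:
  assumes T: "ideal T A" "J \<subseteq> T" and one: "1 \<notin> T"
    and prime: "\<And>a b. a * b \<in> T \<Longrightarrow> a \<in> T \<or> b \<in> T"
  shows "primeideal (cl ` T) Q"
proof (rule primeidealI)
  show "ideal (cl ` T) Q" by (rule ideal_image[OF T(1)])
  show "cring Q" by (rule cring_Q)
  show "carrier Q \<noteq> cl ` T"
    using one cl_in_image_iff[OF T, of 1] unfolding carrier_Q by (metis rangeI)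
  show "x \<in> cl ` T \<or> y \<in> cl ` T"
    if xy: "x \<in> carrier Q" "y \<in> carrier Q" "x \<otimes>\<^bsub>Q\<^esub> y \<in> cl ` T" for x y
  proof -
    obtain a b where ab: "x = cl a" "y = cl b" using xy(1,2) by (auto simp: carrier_Q)
    have "cl (a * b) \<in> cl ` T" using xy(3) unfolding ab Q_simps .
    then have "a * b \<in> T" unfolding cl_in_image_iff[OF T] .
    then have "a \<in> T \<or> b \<in> T" by (rule prime)
    then show ?thesis unfolding ab cl_in_image_iff[OF T] .
  qed
qed

lemma vimage_strict_mono:
  assumes "ideal P Q" "P' \<subset> P"
  shows "cl -` P' \<subset> cl -` P"
proof -
  obtain x where x: "x \<in> P" "x \<notin> P'" using assms(2) by blast
  obtain a where "x = cl a"
    using ideal.Icarr[OF assms(1) x(1)] unfolding carrier_Q by (rule rangeE)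
  with x have "a \<in> cl -` P" "a \<notin> cl -` P'" by simp_all
  moreover have "cl -` P' \<subseteq> cl -` P" using assms(2) by (intro vimage_mono) simp
  ultimately show ?thesis by (metis psubsetI)
qed

definition regular :: "'a \<Rightarrow> bool" where
  "regular a \<longleftrightarrow> (\<forall>y. a * y \<in> J \<longrightarrow> y \<in> J)"

lemma genideal_Q_empty: "genideal Q {} = {cl 0}"
proof -
  interpret cring Q by (rule cring_Q)
  have "genideal Q {} \<subseteq> {cl 0}"
    using genideal_minimal[OF zeroideal, of "{}"] by (simp add: Q_simps)
  moreover have "cl 0 \<in> genideal Q {}"
    using additive_subgroup.zero_closed[OF ideal.axioms(1)[OF genideal_ideal[of "{}"]]]
    by (simp add: Q_simps)
  ultimately show ?thesis by blast
qed

lemma genideal_Q_singleton: "cl y \<in> genideal Q {cl a} \<longleftrightarrow> (\<exists>r. y - r * a \<in> J)"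
proof -
  interpret cring Q by (rule cring_Q)
  have "genideal Q {cl a} = {x \<otimes>\<^bsub>Q\<^esub> cl a |x. x \<in> carrier Q}"
    using cgenideal_eq_genideal[of "cl a"] by (auto simp: cgenideal_def carrier_Q)
  then have "cl y \<in> genideal Q {cl a} \<longleftrightarrow> (\<exists>r. cl y = cl r \<otimes>\<^bsub>Q\<^esub> cl a)"
    by (auto simp: carrier_Q)
  then show ?thesis by (simp only: Q_simps cl_eq_iff)
qed

lemma regular_sequence_hd:
  assumes "regular_sequence Q (cl a # xs)"
  shows "regular a"
  unfolding regular_def
proof (intro allI impI)
  fix y assume "a * y \<in> J"
  then have "cl a \<otimes>\<^bsub>Q\<^esub> cl y \<in> genideal Q {}"
    by (simp add: Q_simps genideal_Q_empty cl_eq_iff)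
  moreover have "\<forall>y \<in> carrier Q. cl a \<otimes>\<^bsub>Q\<^esub> y \<in> genideal Q {} \<longrightarrow> y \<in> genideal Q {}"
    using assms unfolding regular_sequence_def by force
  moreover have "cl y \<in> carrier Q" unfolding carrier_Q by (rule rangeI)
  ultimately have "cl y \<in> genideal Q {}" by simp
  then show "y \<in> J" by (simp add: genideal_Q_empty cl_eq_iff)
qed

lemma regular_sequence_second:
  assumes "regular_sequence Q (cl a # cl b # xs)" and "b * y - r * a \<in> J"
  shows "\<exists>r. y - r * a \<in> J"
proof -
  have "cl b \<otimes>\<^bsub>Q\<^esub> cl y \<in> genideal Q {cl a}"
    using assms(2) by (auto simp: Q_simps genideal_Q_singleton)
  moreover have "\<forall>y \<in> carrier Q. cl b \<otimes>\<^bsub>Q\<^esub> y \<in> genideal Q {cl a} \<longrightarrow> y \<in> genideal Q {cl a}"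
    using assms(1) unfolding regular_sequence_def by force
  moreover have "cl y \<in> carrier Q" unfolding carrier_Q by (rule rangeI)
  ultimately have "cl y \<in> genideal Q {cl a}" by simp
  then show ?thesis unfolding genideal_Q_singleton .
qed

lemma regular_sequence_singleton:
  assumes "ideal P Q" "1 \<notin> cl -` P" "cl a \<in> P" "regular a"
  shows "regular_sequence Q [cl a]"
proof -
  interpret cring Q by (rule cring_Q)
  have "genideal Q {cl a} \<subseteq> P" using genideal_minimal[OF assms(1)] assms(3) by simp
  moreover have "P \<noteq> carrier Q" using assms(2) by (auto simp: carrier_Q)
  moreover have "P \<subseteq> carrier Q" using ideal.Icarr[OF assms(1)] by blast
  ultimately have "genideal Q {cl a} \<noteq> carrier Q" by blast
  then show ?thesis
    using assms(4)
    by (auto simp: regular_sequence_def regular_def carrier_Q Q_simps genideal_Q_empty cl_eq_iff)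
qed

end

section \<open>Rings that are a line modulo nilpotents\<close>

lemma poly_ideal_principal:
  fixes E :: "'k::field poly set"
  assumes add: "\<And>f g. f \<in> E \<Longrightarrow> g \<in> E \<Longrightarrow> f + g \<in> E"
    and mult: "\<And>f g. f \<in> E \<Longrightarrow> g * f \<in> E"
    and ex: "h \<in> E" "h \<noteq> 0"
  shows "\<exists>d. d \<in> E \<and> d \<noteq> 0 \<and> (\<forall>f\<in>E. d dvd f)"
proof -
  define d where "d = arg_min degree (\<lambda>f. f \<in> E \<and> f \<noteq> 0)"
  have d: "d \<in> E" "d \<noteq> 0"
    using arg_min_natI[of "\<lambda>f. f \<in> E \<and> f \<noteq> 0" h degree] ex unfolding d_def by auto
  have min: "degree d \<le> degree f" if "f \<in> E" "f \<noteq> 0" for f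
    using arg_min_nat_le[of "\<lambda>f. f \<in> E \<and> f \<noteq> 0" f degree] that unfolding d_def by auto
  have "d dvd f" if "f \<in> E" for f
  proof -
    have "f mod d = f + (- (f div d)) * d"
      by (simp add: minus_div_mult_eq_mod)
    also have "\<dots> \<in> E" by (rule add[OF that mult[OF d(1)]])
    finally have "f mod d \<in> E" .
    then have "f mod d = 0"
      using min[of "f mod d"] degree_mod_less[OF d(2), of f] by force
    then show ?thesis by (simp add: dvd_eq_mod_eq_0)
  qed
  with d show ?thesis by auto
qed

lemma nilpotents_add:
  fixes J :: "'a::comm_ring_1 set"
  assumes add: "\<And>x y. x \<in> J \<Longrightarrow> y \<in> J \<Longrightarrow> x + y \<in> J" and mult: "\<And>x r. x \<in> J \<Longrightarrow> r * x \<in> J"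
    and zero: "0 \<in> J"
    and a: "a ^ k \<in> J" and b: "b ^ l \<in> J"
  shows "(a + b) ^ (k + l) \<in> J"
proof -
  have sum: "sum f I \<in> J" if "finite I" "\<And>i. i \<in> I \<Longrightarrow> f i \<in> J" for f and I :: "nat set"
    using that by (induction I rule: finite_induct) (auto intro: add zero)
  have pow: "x ^ m \<in> J" if "x ^ n \<in> J" "n \<le> m" for x :: 'a and m n
  proof -
    have "x ^ m = x ^ (m - n) * x ^ n" using that(2) by (simp add: power_add[symmetric])
    then show ?thesis using mult[OF that(1)] by simp
  qed
  have "of_nat (k + l choose i) * a ^ i * b ^ (k + l - i) \<in> J" if "i \<le> k + l" for i
  proof (cases "k \<le> i")
    case True
    then show ?thesis
      using mult[OF pow[OF a True], of "of_nat (k + l choose i) * b ^ (k + l - i)"]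
      by (simp add: mult_ac)
  next
    case False
    then have "l \<le> k + l - i" by simp
    then show ?thesis
      using mult[OF pow[OF b], of "k + l - i" "of_nat (k + l choose i) * a ^ i"] by simp
  qed
  then show ?thesis unfolding binomial_ring by (intro sum) auto
qed

text \<open>The quotient \<open>Q = A/J\<close> contains a copy of \<open>K[x]\<close>, given by \<open>\<phi>\<close>, and every element of \<open>Q\<close> differs from
  an element of this copy by a nilpotent. Thus \<open>Spec Q\<close> is a line with nilpotents. The last
  assumption confines its embedded points to the origin \<open>x = 0\<close>; it holds for graded rings in
  which \<open>x\<close> has positive degree.\<close>
locale line_thickening = type_ideal J for J :: "'a::comm_ring_1 set" +
  fixes \<phi> :: "'k::field poly \<Rightarrow> 'a"
  assumes hom_add: "\<phi> (f + g) = \<phi> f + \<phi> g"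
    and hom_mult: "\<phi> (f * g) = \<phi> f * \<phi> g"
    and hom_one: "\<phi> 1 = 1"
    and hom_inj: "\<phi> f \<in> J \<Longrightarrow> f = 0"
    and nilpotent_part: "\<exists>f k. (a - \<phi> f) ^ k \<in> J"
    and constant_term_regular: "coeff f 0 \<noteq> 0 \<Longrightarrow> \<phi> f * a \<in> J \<Longrightarrow> a \<in> J"
begin

lemma hom_power: "\<phi> (f ^ k) = \<phi> f ^ k"
  by (induction k) (simp_all add: hom_one hom_mult)

lemma hom_zero: "\<phi> 0 = 0"
  using hom_add[of 0 0] by simp

lemma hom_uminus: "\<phi> (- f) = - \<phi> f"
  using hom_add[of f "- f"] by (simp add: hom_zero eq_neg_iff_add_eq_0 add.commute)

lemma hom_diff: "\<phi> (f - g) = \<phi> f - \<phi> g"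
  using hom_add[of f "- g"] by (simp add: hom_uminus)

abbreviation param :: 'a where "param \<equiv> \<phi> (Polynomial.monom 1 1)"

text \<open>The preimage in \<open>A\<close> of the nilradical of \<open>Q\<close>.\<close>
definition nilradical :: "'a set" where "nilradical = {a. \<exists>k. a ^ k \<in> J}"

lemma J_subset_nilradical: "J \<subseteq> nilradical"
  unfolding nilradical_def by (auto intro: exI[of _ 1])

lemma nilradical_add: "a \<in> nilradical \<Longrightarrow> b \<in> nilradical \<Longrightarrow> a + b \<in> nilradical"
  unfolding nilradical_def using nilpotents_add[OF J_add J_mult J_zero] by blast

lemma nilradical_mult: "a \<in> nilradical \<Longrightarrow> r * a \<in> nilradical"
  unfolding nilradical_def by (auto simp: power_mult_distrib intro: J_mult)

lemma nilradical_zero: "0 \<in> nilradical"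
  using J_subset_nilradical J_zero by blast

lemma nilradical_uminus: "a \<in> nilradical \<Longrightarrow> - a \<in> nilradical"
  using nilradical_mult[of a "- 1"] by simp

lemma nilradical_diff: "a \<in> nilradical \<Longrightarrow> b \<in> nilradical \<Longrightarrow> a - b \<in> nilradical"
  using nilradical_add[OF _ nilradical_uminus] by simp

lemma hom_in_nilradical_iff: "\<phi> f \<in> nilradical \<longleftrightarrow> f = 0"
proof
  assume "\<phi> f \<in> nilradical"
  then obtain k where "\<phi> (f ^ k) \<in> J" unfolding nilradical_def hom_power by blast
  then have "f ^ k = 0" by (rule hom_inj)
  then show "f = 0" by simp
qed (simp add: hom_zero nilradical_zero)

lemma poly_part: obtains f where "a - \<phi> f \<in> nilradical"
  using nilpotent_part[of a] unfolding nilradical_def by blast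

text \<open>Modulo \<open>a\<close>, an element that differs from \<open>a\<close> by a nilpotent is itself nilpotent. This moves
  statements about elements of \<open>Q\<close> to statements about polynomials.\<close>
lemma power_diff_nilradical:
  assumes "a - b \<in> nilradical"
  obtains k q where "b ^ k - q * a \<in> J"
proof -
  have "b - a \<in> nilradical" using nilradical_uminus[OF assms] by simp
  then obtain k where k: "(b - a) ^ k \<in> J" unfolding nilradical_def by blast
  have "\<exists>q. b ^ k - (b - a) ^ k = q * a"
  proof (induction k)
    case (Suc k)
    then obtain q where "b ^ k - (b - a) ^ k = q * a" by blast
    then have "b ^ Suc k - (b - a) ^ Suc k = (q * b + (b - a) ^ k) * a"
      by (simp add: algebra_simps)
    then show ?case by blast
  qed (auto intro: exI[of _ 0])
  then obtain q where "b ^ k - (b - a) ^ k = q * a" by blast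
  then have "b ^ k - q * a = (b - a) ^ k" by (simp add: algebra_simps)
  with k that show ?thesis by metis
qed

lemma prime_contains_nilradical:
  assumes "primeideal P Q"
  shows "nilradical \<subseteq> cl -` P"
proof
  fix a assume "a \<in> nilradical"
  then obtain k where k: "a ^ k \<in> J" unfolding nilradical_def by blast
  note P = ideal_vimage[OF primeideal.axioms(1)[OF assms]]
  have "a ^ k \<in> cl -` P \<Longrightarrow> a \<in> cl -` P" for k
  proof (induction k)
    case 0
    then show ?case using primeideal_vimage(2)[OF assms] by simp
  next
    case (Suc k)
    then show ?case using primeideal_vimage(1)[OF assms, of a "a ^ k"] by auto
  qed
  then show "a \<in> cl -` P" using k P(2) by blast
qed

text \<open>Contracting primes to \<open>K[x]\<close> loses nothing, since a prime contains all nilpotents; so chains of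
  primes of \<open>Q\<close> are chains of primes of the principal ideal domain \<open>K[x]\<close>.\<close>
definition contraction :: "'a set set \<Rightarrow> 'k poly set" where
  "contraction P = {f. cl (\<phi> f) \<in> P}"

lemma contraction_ideal:
  assumes "ideal P Q"
  shows "f \<in> contraction P \<Longrightarrow> g \<in> contraction P \<Longrightarrow> f + g \<in> contraction P" "f \<in> contraction P \<Longrightarrow> h * f \<in> contraction P"
    "0 \<in> contraction P"
  using ideal_vimage(1)[OF assms] unfolding type_ring_ideal_iff contraction_def
  by (simp_all add: hom_add hom_mult hom_zero)

lemma contraction_prime:
  assumes "primeideal P Q"
  shows "f * g \<in> contraction P \<Longrightarrow> f \<in> contraction P \<or> g \<in> contraction P" "1 \<notin> contraction P"
  using primeideal_vimage[OF assms] unfolding contraction_def by (simp_all add: hom_mult hom_one)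

lemma contraction_strict_mono:
  assumes P: "primeideal P Q" "primeideal P' Q" and lt: "P' \<subset> P"
  shows "contraction P' \<subset> contraction P"
proof -
  note iP = ideal_vimage(1)[OF primeideal.axioms(1)[OF P(1)]]
  note iP' = ideal_vimage(1)[OF primeideal.axioms(1)[OF P(2)]]
  obtain a where a: "cl a \<in> P" "cl a \<notin> P'"
    using psubset_imp_ex_mem[OF vimage_strict_mono[OF primeideal.axioms(1)[OF P(1)] lt]] by auto
  obtain f where f: "a - \<phi> f \<in> nilradical" by (rule poly_part)
  have "a - \<phi> f \<in> cl -` P" "a - \<phi> f \<in> cl -` P'"
    using f prime_contains_nilradical P by (metis subsetD)+
  then have "a - (a - \<phi> f) \<in> cl -` P" and "\<phi> f \<in> cl -` P' \<Longrightarrow> (a - \<phi> f) + \<phi> f \<in> cl -` P'"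
    using type_ring_idealD(4)[OF iP, of a "a - \<phi> f"] type_ring_idealD(2)[OF iP', of "a - \<phi> f" "\<phi> f"] a(1)
    by simp_all
  then have "f \<in> contraction P" "f \<notin> contraction P'"
    using a(2) unfolding contraction_def by auto
  moreover have "contraction P' \<subseteq> contraction P" using lt unfolding contraction_def by auto
  ultimately show ?thesis by auto
qed

text \<open>In \<open>K[x]\<close> a nonzero prime \<open>(p)\<close> is maximal: a strictly larger prime \<open>(d)\<close> would give
  \<open>p = d q\<close> with \<open>q\<close> in \<open>(p)\<close>, which makes \<open>d\<close> a unit.\<close>
lemma no_long_prime_chain:
  assumes P: "primeideal P0 Q" "primeideal P1 Q" "primeideal P2 Q" and lt: "P0 \<subset> P1" "P1 \<subset> P2"
  shows False
proof -
  note i = P[THEN primeideal.axioms(1)]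
  have t: "contraction P0 \<subset> contraction P1" "contraction P1 \<subset> contraction P2"
    by (rule contraction_strict_mono[OF P(2,1) lt(1)], rule contraction_strict_mono[OF P(3,2) lt(2)])
  obtain h where h: "h \<in> contraction P1" "h \<noteq> 0"
    using t(1) contraction_ideal(3)[OF i(1)] by blast
  obtain p where p: "p \<in> contraction P1" "p \<noteq> 0" "\<And>f. f \<in> contraction P1 \<Longrightarrow> p dvd f"
    using poly_ideal_principal[OF contraction_ideal(1,2)[OF i(2)] h] by auto
  have "h \<in> contraction P2" using h t(2) by blast
  then obtain d where d: "d \<in> contraction P2" "d \<noteq> 0" "\<And>f. f \<in> contraction P2 \<Longrightarrow> d dvd f"
    using poly_ideal_principal[OF contraction_ideal(1,2)[OF i(3)] _ h(2)] by auto
  have "p \<in> contraction P2" using p(1) t(2) by blast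
  from d(3)[OF this] obtain q where q: "p = d * q" by (rule dvdE)
  have "d * q \<in> contraction P1" using p(1) unfolding q .
  from contraction_prime(1)[OF P(2) this] consider "d \<in> contraction P1" | "q \<in> contraction P1" by (rule disjE)
  then show False
  proof cases
    case 1
    have "f \<in> contraction P1" if "f \<in> contraction P2" for f
    proof -
      from d(3)[OF that] obtain r where "f = d * r" by (rule dvdE)
      then show ?thesis using contraction_ideal(2)[OF i(2) 1, of r] by (simp add: mult.commute)
    qed
    with t(2) show False by blast
  next
    case 2
    from p(3)[OF this] obtain r where "q = p * r" by (rule dvdE)
    with q p(2) have "d * r = 1" by auto
    then have "1 \<in> contraction P2" using contraction_ideal(2)[OF i(3) d(1), of r] by (simp add: mult.commute)
    with contraction_prime(2)[OF P(3)] show False ..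
  qed
qed

lemma nilradical_ideal: "ideal nilradical A"
  unfolding type_ring_ideal_iff by (simp add: nilradical_add nilradical_mult nilradical_zero)

lemma nilradical_prime: "primeideal (cl ` nilradical) Q"
proof (rule primeideal_image[OF nilradical_ideal J_subset_nilradical])
  show "1 \<notin> nilradical" using hom_in_nilradical_iff[of 1] unfolding hom_one by simp
  fix a b assume ab: "a * b \<in> nilradical"
  obtain f where f: "a - \<phi> f \<in> nilradical" by (rule poly_part)
  obtain g where g: "b - \<phi> g \<in> nilradical" by (rule poly_part)
  have "\<phi> (f * g) = a * b - (b * (a - \<phi> f) + \<phi> f * (b - \<phi> g))"
    by (simp add: hom_mult algebra_simps)
  also have "\<dots> \<in> nilradical" by (rule nilradical_diff[OF ab nilradical_add[OF nilradical_mult[OF f] nilradical_mult[OF g]]])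
  finally have "f = 0 \<or> g = 0" unfolding hom_in_nilradical_iff by simp
  then show "a \<in> nilradical \<or> b \<in> nilradical" using f g by (auto simp: hom_zero)
qed

text \<open>The preimage in \<open>A\<close> of the maximal ideal of \<open>Q\<close> at the point \<open>x = 0\<close> of the line.\<close>
definition origin :: "'a set" where
  "origin = {a. \<exists>f. a - \<phi> f \<in> nilradical \<and> coeff f 0 = 0}"

lemma origin_ideal: "ideal origin A"
  unfolding type_ring_ideal_iff
proof (intro conjI ballI allI)
  show "0 \<in> origin"
    unfolding origin_def using nilradical_zero by (auto simp: hom_zero intro!: exI[of _ 0])
next
  fix a b assume "a \<in> origin" "b \<in> origin"
  then obtain f g where f: "a - \<phi> f \<in> nilradical" "coeff f 0 = 0" and g: "b - \<phi> g \<in> nilradical" "coeff g 0 = 0"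
    unfolding origin_def by blast
  have "(a + b) - \<phi> (f + g) = (a - \<phi> f) + (b - \<phi> g)" by (simp add: hom_add)
  also have "\<dots> \<in> nilradical" by (rule nilradical_add[OF f(1) g(1)])
  finally show "a + b \<in> origin"
    unfolding origin_def using f(2) g(2) by (auto intro!: exI[of _ "f + g"])
next
  fix a r assume "a \<in> origin"
  then obtain f where f: "a - \<phi> f \<in> nilradical" "coeff f 0 = 0" unfolding origin_def by blast
  obtain g where g: "r - \<phi> g \<in> nilradical" by (rule poly_part)
  have "r * a - \<phi> (g * f) = r * (a - \<phi> f) + \<phi> f * (r - \<phi> g)"
    by (simp add: hom_mult algebra_simps)
  also have "\<dots> \<in> nilradical" by (rule nilradical_add[OF nilradical_mult[OF f(1)] nilradical_mult[OF g]])
  finally show "r * a \<in> origin"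
    unfolding origin_def using f(2) by (auto simp: coeff_mult intro!: exI[of _ "g * f"])
qed

lemma nilradical_subset_origin: "nilradical \<subseteq> origin"
  unfolding origin_def by (auto simp: hom_zero intro!: exI[of _ 0])

lemma hom_in_origin_iff: "\<phi> f \<in> origin \<longleftrightarrow> coeff f 0 = 0"
proof
  assume "\<phi> f \<in> origin"
  then obtain g where "\<phi> (f - g) \<in> nilradical" "coeff g 0 = 0" unfolding origin_def hom_diff by blast
  then show "coeff f 0 = 0" unfolding hom_in_nilradical_iff by simp
qed (auto simp: origin_def nilradical_zero intro!: exI[of _ f])

lemma origin_maximal: "maximalideal (cl ` origin) Q"
proof (rule maximalidealI)
  have sub: "J \<subseteq> origin" using J_subset_nilradical nilradical_subset_origin by (rule subset_trans)
  note in_iff = cl_in_image_iff[OF origin_ideal sub]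
  show "ideal (cl ` origin) Q" by (rule ideal_image[OF origin_ideal])
  have "cl 1 \<notin> cl ` origin" using hom_in_origin_iff[of 1] unfolding in_iff hom_one by simp
  then show "carrier Q \<noteq> cl ` origin" unfolding carrier_Q by (metis rangeI)
  fix M assume M: "ideal M Q" "cl ` origin \<subseteq> M" "M \<subseteq> carrier Q"
  note iM = type_ring_idealD[OF ideal_vimage(1)[OF M(1)]]
  have oM: "a \<in> cl -` M" if "a \<in> origin" for a
    using M(2) that by auto
  show "M = cl ` origin \<or> M = carrier Q"
  proof (cases "cl -` M \<subseteq> origin")
    case True
    have "M \<subseteq> cl ` origin"
    proof
      fix x assume x: "x \<in> M"
      then have "x \<in> range cl" using M(3) carrier_Q by auto
      then obtain a where "x = cl a" by (rule rangeE)
      with True x show "x \<in> cl ` origin" by auto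
    qed
    with M(2) show ?thesis by (simp add: subset_antisym)
  next
    case False
    then obtain a where a: "a \<in> cl -` M" "a \<notin> origin" by (meson subsetI)
    obtain f where f: "a - \<phi> f \<in> nilradical" by (rule poly_part)
    define c where "c = coeff f 0"
    have c: "c \<noteq> 0" using a(2) f unfolding origin_def c_def by blast
    have "a - \<phi> [:c:] = (a - \<phi> f) + \<phi> (f - [:c:])" by (simp add: hom_diff)
    also have "\<dots> \<in> origin"
      using type_ring_idealD(2)[OF origin_ideal] subsetD[OF nilradical_subset_origin f]
        hom_in_origin_iff[of "f - [:c:]"] by (simp add: c_def)
    finally have "a - \<phi> [:c:] \<in> cl -` M" by (rule oM)
    with iM(4)[OF a(1) this] have "\<phi> [:c:] \<in> cl -` M" by simp
    then have "\<phi> [:1 / c:] * \<phi> [:c:] \<in> cl -` M" by (rule iM(3))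
    then have "cl 1 \<in> M" using c by (simp add: hom_mult[symmetric] hom_one flip: one_pCons)
    then show ?thesis using ideal.one_imp_carrier[OF M(1)] by (simp add: Q_simps)
  qed
qed

lemma regular_power:
  assumes "regular a" "a ^ k * y \<in> J"
  shows "y \<in> J"
  using assms(2)
proof (induction k)
  case (Suc k)
  then show ?case using assms(1) unfolding regular_def by (simp add: mult.assoc)
qed simp

text \<open>The depth is at most the dimension. Let \<open>a, b\<close> in \<open>P\<close> be a regular sequence with polynomial parts
  \<open>f, g\<close>. The ideal \<open>H\<close> of polynomials that vanish in \<open>Q/(a)\<close> contains a power of
  \<open>f \<noteq> 0\<close>, so \<open>K[x]/H\<close> is finite-dimensional; since \<open>b\<close> is a nonzerodivisor on \<open>Q/(a)\<close>, so is
  \<open>g\<close> on \<open>K[x]/H\<close>, and \<open>g\<close> is a unit there. But \<open>H\<close> and \<open>g\<close> both lie in the contraction of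
  \<open>P\<close>, which is proper. Dimensions are replaced by divisibility: \<open>H = (h0)\<close> and
  \<open>(h0, g) = (d)\<close>, and cancelling \<open>g\<close> shows that \<open>d\<close> is a unit.\<close>
lemma regular_sequence_length_le_1:
  assumes P: "primeideal P Q" and xs: "regular_sequence Q xs" "set xs \<subseteq> P"
  shows "length xs \<le> 1"
proof (rule ccontr)
  assume "\<not> length xs \<le> 1"
  then obtain x y zs where xs_eq: "xs = x # y # zs"
    by (cases xs rule: list.exhaust; cases "tl xs" rule: list.exhaust) auto
  note iP = ideal_vimage[OF primeideal.axioms(1)[OF P]]
  note dP = type_ring_idealD[OF iP(1)]
  have "x \<in> range cl" "y \<in> range cl"
    using xs(1) carrier_Q unfolding regular_sequence_def xs_eq by auto
  then obtain a b where ab: "x = cl a" "y = cl b" by auto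
  have seq: "regular_sequence Q (cl a # cl b # zs)" using xs(1) unfolding xs_eq ab .
  have a: "regular a" by (rule regular_sequence_hd[OF seq])
  have aP: "a \<in> cl -` P" and bP: "b \<in> cl -` P" using xs(2) unfolding xs_eq ab by auto
  obtain f where f: "a - \<phi> f \<in> nilradical" by (rule poly_part)
  obtain g where g: "b - \<phi> g \<in> nilradical" by (rule poly_part)
  have "f \<noteq> 0"
  proof
    assume "f = 0"
    with f obtain k where "a ^ k * 1 \<in> J" unfolding nilradical_def by (auto simp: hom_zero)
    from regular_power[OF a this] have "1 \<in> cl -` P" using iP(2) by auto
    with primeideal_vimage(2)[OF P] show False ..
  qed
  define H where "H = {h. \<exists>r. \<phi> h - r * a \<in> J}"
  have H_add: "h + h' \<in> H" if "h \<in> H" "h' \<in> H" for h h'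
  proof -
    obtain r r' where "\<phi> h - r * a \<in> J" "\<phi> h' - r' * a \<in> J" using \<open>h \<in> H\<close> \<open>h' \<in> H\<close> unfolding H_def by auto
    from J_add[OF this] have "\<phi> (h + h') - (r + r') * a \<in> J"
      by (simp add: hom_add algebra_simps)
    then show ?thesis unfolding H_def by auto
  qed
  have H_mult: "u * h \<in> H" if "h \<in> H" for h u
  proof -
    obtain r where "\<phi> h - r * a \<in> J" using \<open>h \<in> H\<close> unfolding H_def by auto
    from J_mult[OF this, of "\<phi> u"] have "\<phi> (u * h) - (\<phi> u * r) * a \<in> J"
      by (simp add: hom_mult algebra_simps)
    then show ?thesis unfolding H_def by auto
  qed
  obtain k q where "\<phi> f ^ k - q * a \<in> J" by (rule power_diff_nilradical[OF f])
  then have fH: "f ^ k \<in> H" unfolding H_def by (auto simp: hom_power)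
  have f0: "f ^ k \<noteq> 0" using \<open>f \<noteq> 0\<close> by simp
  obtain h0 where h0: "h0 \<in> H" "h0 \<noteq> 0" "\<And>h. h \<in> H \<Longrightarrow> h0 dvd h"
    using poly_ideal_principal[OF H_add H_mult fH f0] by auto
  have H_contraction: "h \<in> contraction P" if "h \<in> H" for h
  proof -
    obtain r where "\<phi> h - r * a \<in> J" using \<open>h \<in> H\<close> unfolding H_def by auto
    then have "\<phi> h - r * a \<in> cl -` P" using iP(2) by auto
    from dP(2)[OF this dP(3)[OF aP, of r]] show ?thesis unfolding contraction_def by simp
  qed
  have "b - \<phi> g \<in> cl -` P" using g prime_contains_nilradical[OF P] by auto
  from dP(4)[OF bP this] have g_contraction: "g \<in> contraction P" unfolding contraction_def by simp
  have cancel: "h \<in> H" if h: "g * h \<in> H" for h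
  proof -
    obtain r where r: "\<phi> (g * h) - r * a \<in> J" using h unfolding H_def by auto
    have "\<phi> g - b \<in> nilradical" using nilradical_uminus[OF g] by simp
    then obtain k q where k: "b ^ k - q * \<phi> g \<in> J" by (rule power_diff_nilradical)
    have "b ^ k * \<phi> h - (q * r) * a = \<phi> h * (b ^ k - q * \<phi> g) + q * (\<phi> (g * h) - r * a)"
      by (simp add: hom_mult algebra_simps)
    also have "\<dots> \<in> J" by (rule J_add[OF J_mult[OF k] J_mult[OF r]])
    finally have "b ^ k * \<phi> h - (q * r) * a \<in> J" .
    then have "\<exists>r. b ^ k * \<phi> h - r * a \<in> J" ..
    then have "\<exists>r. \<phi> h - r * a \<in> J"
    proof (induction k)
      case (Suc k)
      then obtain r where "b * (b ^ k * \<phi> h) - r * a \<in> J" by (auto simp: mult.assoc)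
      from regular_sequence_second[OF seq this] show ?case by (rule Suc.IH)
    qed simp
    then show ?thesis unfolding H_def by simp
  qed
  define E where "E = {u * h0 + v * g | u v. True}"
  have E_add: "e + e' \<in> E" if e: "e \<in> E" "e' \<in> E" for e e'
  proof -
    obtain u v u' v' where "e = u * h0 + v * g" "e' = u' * h0 + v' * g" using e unfolding E_def by auto
    then have "e + e' = (u + u') * h0 + (v + v') * g" by (simp add: algebra_simps)
    then show ?thesis unfolding E_def by auto
  qed
  have E_mult: "w * e \<in> E" if e: "e \<in> E" for e w
  proof -
    obtain u v where "e = u * h0 + v * g" using e unfolding E_def by auto
    then have "w * e = (w * u) * h0 + (w * v) * g" by (simp add: algebra_simps)
    then show ?thesis unfolding E_def by auto
  qed
  have "h0 = 1 * h0 + 0 * g" "g = 0 * h0 + 1 * g" by simp_all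
  then have hE: "h0 \<in> E" and gE: "g \<in> E" unfolding E_def mem_Collect_eq by metis+
  obtain d where d: "d \<in> E" "d \<noteq> 0" "\<And>e. e \<in> E \<Longrightarrow> d dvd e"
    using poly_ideal_principal[OF E_add E_mult hE h0(2)] by auto
  from d(3)[OF hE] obtain q where q: "h0 = d * q" by (rule dvdE)
  from d(3)[OF gE] obtain g' where g': "g = d * g'" by (rule dvdE)
  have "g * q = g' * h0" unfolding q g' by simp
  then have "g * q \<in> H" using H_mult[OF h0(1)] by simp
  from h0(3)[OF cancel[OF this]] obtain r where "q = h0 * r" by (rule dvdE)
  with q have "h0 * 1 = h0 * (d * r)" by simp
  then have "d * r = 1" using h0(2) by (metis mult_left_cancel)
  moreover obtain u v where "d = u * h0 + v * g" using d(1) unfolding E_def by auto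
  ultimately have "r * (u * h0 + v * g) = 1" by (simp add: mult.commute)
  moreover have "r * (u * h0 + v * g) \<in> contraction P"
    using contraction_ideal[OF primeideal.axioms(1)[OF P]] H_contraction[OF h0(1)] g_contraction by simp
  ultimately show False using contraction_prime(2)[OF P] by simp
qed

lemma image_nilradical_psubset_maximal:
  assumes P: "maximalideal P Q"
  shows "cl ` nilradical \<subset> P"
proof -
  interpret maximalideal P Q by (rule P)
  have Pp: "primeideal P Q" by (rule cring.maximalideal_prime[OF cring_Q P])
  have sub: "cl ` nilradical \<subseteq> P" using prime_contains_nilradical[OF Pp] by auto
  have "cl ` nilradical \<noteq> P"
  proof
    assume eq: "cl ` nilradical = P"
    interpret O: maximalideal "cl ` origin" Q by (rule origin_maximal)
    have "cl ` nilradical \<subseteq> cl ` origin" using nilradical_subset_origin by (rule image_mono)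
    then have "cl ` origin = P"
      using I_maximal[OF O.is_ideal] O.I_notcarr O.a_subset unfolding eq by metis
    moreover have "param \<in> origin" unfolding hom_in_origin_iff by simp
    ultimately have "cl param \<in> cl ` nilradical" unfolding eq by auto
    then have "param \<in> nilradical" unfolding cl_in_image_iff[OF nilradical_ideal J_subset_nilradical] .
    then show False unfolding hom_in_nilradical_iff by simp
  qed
  with sub show ?thesis by (simp add: psubsetI)
qed

lemma prime_height_maximal:
  assumes P: "maximalideal P Q"
  shows "prime_height Q P = 1"
proof -
  have Pp: "primeideal P Q" by (rule cring.maximalideal_prime[OF cring_Q P])
  let ?S = "{enat k | k. \<exists>C :: nat \<Rightarrow> 'a set set.
            (\<forall>i\<le>k. primeideal (C i) Q) \<and> (\<forall>i<k. C i \<subset> C (Suc i)) \<and> C k = P}"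
  define C where "C = (\<lambda>i::nat. if i = 0 then cl ` nilradical else P)"
  have "(\<forall>i\<le>1. primeideal (C i) Q) \<and> (\<forall>i<1. C i \<subset> C (Suc i)) \<and> C 1 = P"
    using Pp nilradical_prime image_nilradical_psubset_maximal[OF P] unfolding C_def by simp
  then have "enat 1 \<in> ?S" by auto
  moreover have "s \<le> 1" if s: "s \<in> ?S" for s
  proof -
    obtain k and C :: "nat \<Rightarrow> 'a set set" where k: "s = enat k" "\<forall>i\<le>k. primeideal (C i) Q"
      "\<forall>i<k. C i \<subset> C (Suc i)" using s by auto
    have "k \<le> 1"
    proof (rule ccontr)
      assume "\<not> k \<le> 1"
      then have "primeideal (C 0) Q" "primeideal (C 1) Q" "primeideal (C 2) Q" "C 0 \<subset> C 1" "C 1 \<subset> C 2"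
        using k(2) k(3)[rule_format, of 0] k(3)[rule_format, of 1]
        by (simp_all add: numeral_2_eq_2)
      then show False by (rule no_long_prime_chain)
    qed
    then show ?thesis unfolding k(1) one_enat_def by simp
  qed
  ultimately have "Sup ?S = 1"
    by (intro antisym Sup_least Sup_upper) (simp_all add: one_enat_def)
  then show ?thesis unfolding prime_height_def .
qed

lemma regular_mult:
  assumes "regular a" "regular b"
  shows "regular (a * b)"
  unfolding regular_def
proof (intro allI impI)
  fix y assume "a * b * y \<in> J"
  then have "a * (b * y) \<in> J" by (simp add: mult.assoc)
  then have "b * y \<in> J" using assms(1) unfolding regular_def by simp
  then show "y \<in> J" using assms(2) unfolding regular_def by simp
qed

text \<open>A nonzero polynomial is a power of \<open>x\<close> times a polynomial with nonzero constant term.\<close>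
lemma hom_regular:
  assumes "regular param" "f \<noteq> 0"
  shows "regular (\<phi> f)"
  using assms(2)
proof (induction f)
  case (pCons c f)
  show ?case
  proof (cases "c = 0")
    case True
    then have f: "f \<noteq> 0" using pCons by simp
    have eq: "pCons c f = Polynomial.monom 1 1 * f" using True by (simp add: monom_altdef)
    show ?thesis
      unfolding eq hom_mult by (rule regular_mult[OF assms(1) pCons.IH[OF f]])
  next
    case False
    then show ?thesis using constant_term_regular[of "pCons c f"] unfolding regular_def by simp
  qed
qed simp

text \<open>All maximal ideals have height 1, so the ring is Cohen-Macaulay when each of them contains a
  nonzerodivisor. If \<open>x\<close> is one, then so is every nonzero polynomial, and each maximal ideal
  contains some. Conversely a nonzerodivisor at the origin is \<open>x g\<close> plus a nilpotent, so one of its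
  powers is a multiple of \<open>x\<close>.\<close>
theorem cohen_macaulay_iff_param_regular: "cohen_macaulay Q \<longleftrightarrow> regular param"
proof
  assume cm: "cohen_macaulay Q"
  let ?P = "cl ` origin"
  have "ideal_depth Q ?P = 1"
    using cm origin_maximal prime_height_maximal[OF origin_maximal] unfolding cohen_macaulay_def
    by simp
  then have "\<not> Sup {enat (length xs) | xs. regular_sequence Q xs \<and> set xs \<subseteq> ?P} \<le> 0"
    unfolding ideal_depth_def by simp
  then obtain xs where xs: "regular_sequence Q xs" "set xs \<subseteq> ?P" "enat (length xs) > 0"
    unfolding Sup_le_iff by (auto simp: not_le)
  then obtain x ys where "xs = x # ys" by (cases xs) (auto simp: enat_0)
  with xs obtain a where a: "a \<in> origin" "regular_sequence Q (cl a # ys)" by auto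
  note reg = regular_sequence_hd[OF a(2)]
  obtain f where f: "a - \<phi> f \<in> nilradical" "coeff f 0 = 0" using a(1) unfolding origin_def by auto
  obtain g where g: "f = Polynomial.monom 1 1 * g" using f(2) by (cases f) (auto simp: monom_altdef)
  have "\<phi> f - a \<in> nilradical" using nilradical_uminus[OF f(1)] by simp
  then obtain k q where k: "a ^ k - q * \<phi> f \<in> J" by (rule power_diff_nilradical)
  show "regular param"
    unfolding regular_def
  proof (intro allI impI)
    fix y assume y: "param * y \<in> J"
    have "a ^ k * y = y * (a ^ k - q * \<phi> f) + (q * \<phi> g) * (param * y)"
      unfolding g hom_mult by (simp add: algebra_simps)
    also have "\<dots> \<in> J" by (rule J_add[OF J_mult[OF k] J_mult[OF y]])
    finally show "y \<in> J" by (rule regular_power[OF reg])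
  qed
next
  assume reg: "regular param"
  show "cohen_macaulay Q"
    unfolding cohen_macaulay_def
  proof (intro allI impI)
    fix P assume P: "maximalideal P Q"
    have Pp: "primeideal P Q" by (rule cring.maximalideal_prime[OF cring_Q P])
    have "contraction (cl ` nilradical) \<subset> contraction P"
      by (rule contraction_strict_mono[OF Pp nilradical_prime image_nilradical_psubset_maximal[OF P]])
    from psubset_imp_ex_mem[OF this] obtain f where f: "f \<in> contraction P" "f \<notin> contraction (cl ` nilradical)" by auto
    have "f \<noteq> 0" using f(2) contraction_ideal(3)[OF primeideal.axioms(1)[OF nilradical_prime]] by auto
    have "regular_sequence Q [cl (\<phi> f)]"
      using f(1) primeideal_vimage(2)[OF Pp] hom_regular[OF reg \<open>f \<noteq> 0\<close>] unfolding contraction_def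
      by (intro regular_sequence_singleton[OF primeideal.axioms(1)[OF Pp]]) simp_all
    then have "enat 1 \<in> {enat (length xs) | xs. regular_sequence Q xs \<and> set xs \<subseteq> P}"
      using f(1) unfolding contraction_def mem_Collect_eq by (intro exI[of _ "[cl (\<phi> f)]"]) simp
    moreover have "s \<le> 1" if "s \<in> {enat (length xs) | xs. regular_sequence Q xs \<and> set xs \<subseteq> P}" for s
      using that regular_sequence_length_le_1[OF Pp] by (auto simp: one_enat_def)
    ultimately have "ideal_depth Q P = 1"
      unfolding ideal_depth_def by (intro antisym Sup_least Sup_upper) (simp_all add: one_enat_def)
    then show "ideal_depth Q P = prime_height Q P" by (simp add: prime_height_maximal[OF P])
  qed
qed

end

section \<open>The initial ideal and lengths of factorizations\<close>

lemma mpoly_induct [case_names single add]: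
  fixes f :: "'m \<Rightarrow>\<^sub>0 'k::comm_monoid_add"
  assumes single: "\<And>m c. P (Poly_Mapping.single m c)" and add: "\<And>f g. P f \<Longrightarrow> P g \<Longrightarrow> P (f + g)"
  shows "P f"
proof -
  have "P (\<Sum>m\<in>M. Poly_Mapping.single m (Poly_Mapping.lookup f m))" if "finite M" for M
    using that
  proof (induction M rule: finite_induct)
    case empty
    show ?case using single[of undefined 0] by simp
  qed (simp add: single add)
  moreover have "f = (\<Sum>m\<in>Poly_Mapping.keys f. Poly_Mapping.single m (Poly_Mapping.lookup f m))"
    by (rule poly_mapping_eqI)
      (simp add: lookup_sum lookup_single when_def not_in_keys_iff_lookup_eq_zero)
  ultimately show ?thesis by (metis finite_keys)
qed

definition coeff_sum :: "('m \<Rightarrow> bool) \<Rightarrow> ('m \<Rightarrow>\<^sub>0 'k::comm_ring_1) \<Rightarrow> 'k" where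
  "coeff_sum P f = (\<Sum>m\<in>{m \<in> Poly_Mapping.keys f. P m}. Poly_Mapping.lookup f m)"

lemma coeff_sum_altdef:
  assumes "finite M" "Poly_Mapping.keys f \<subseteq> M"
  shows "coeff_sum P f = (\<Sum>m\<in>M. if P m then Poly_Mapping.lookup f m else 0)"
proof -
  have "coeff_sum P f = (\<Sum>m\<in>Poly_Mapping.keys f. if P m then Poly_Mapping.lookup f m else 0)"
    unfolding coeff_sum_def by (rule sum.inter_filter) simp
  also have "\<dots> = (\<Sum>m\<in>M. if P m then Poly_Mapping.lookup f m else 0)"
    using assms by (intro sum.mono_neutral_left) (auto simp: not_in_keys_iff_lookup_eq_zero)
  finally show ?thesis .
qed

lemma coeff_sum_add: "coeff_sum P (f + g) = coeff_sum P f + coeff_sum P g"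
proof -
  let ?M = "Poly_Mapping.keys f \<union> Poly_Mapping.keys g"
  have M: "finite ?M" "Poly_Mapping.keys f \<subseteq> ?M" "Poly_Mapping.keys g \<subseteq> ?M"
    "Poly_Mapping.keys (f + g) \<subseteq> ?M" using keys_add[of f g] by auto
  show ?thesis
    unfolding coeff_sum_altdef[OF M(1,2)] coeff_sum_altdef[OF M(1,3)] coeff_sum_altdef[OF M(1,4)]
    by (simp add: sum.distrib[symmetric] lookup_add if_distrib cong: if_cong)
qed

lemma coeff_sum_single: "coeff_sum P (Poly_Mapping.single m c) = (if P m then c else 0)"
  by (subst coeff_sum_altdef[of "{m}"]) auto

lemma coeff_sum_zero: "coeff_sum P 0 = 0"
  by (simp add: coeff_sum_def)

lemma coeff_sum_cong:
  assumes "\<And>m. m \<in> Poly_Mapping.keys f \<Longrightarrow> P m \<longleftrightarrow> P' m"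
  shows "coeff_sum P f = coeff_sum P' f"
  unfolding coeff_sum_def using assms by (intro sum.cong) auto

lemma coeff_sum_False: 
  assumes "\<And>m. m \<in> Poly_Mapping.keys f \<Longrightarrow> \<not> P m"
  shows "coeff_sum P f = 0"
  unfolding coeff_sum_def using assms by (intro sum.neutral) auto

lemma coeff_sum_eq_lookup: "coeff_sum (\<lambda>m'. m' = m) f = Poly_Mapping.lookup f m"
  by (induction f rule: mpoly_induct) (simp_all add: coeff_sum_single coeff_sum_add lookup_single lookup_add when_def)

lemma coeff_sum_monomial_mult:
  fixes f :: "'m::monoid_add \<Rightarrow>\<^sub>0 'k::comm_ring_1"
  shows "coeff_sum P (Poly_Mapping.single u c * f) = c * coeff_sum (\<lambda>m. P (u + m)) f"
  by (induction f rule: mpoly_induct)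
     (simp_all add: mult_single coeff_sum_single coeff_sum_add distrib_left)

lemma coeff_sum_uminus: "coeff_sum P (- f) = - coeff_sum P f"
  using coeff_sum_add[of P f "- f"] by (simp add: coeff_sum_zero eq_neg_iff_add_eq_0 add.commute)

lemma coeff_sum_diff: "coeff_sum P (f - g) = coeff_sum P f - coeff_sum P g"
  using coeff_sum_add[of P f "- g"] by (simp add: coeff_sum_uminus)

text \<open>A monomial is a factorization of its weight in the semigroup, and its total degree is the
  length of this factorization.\<close>
definition weight :: "('i::finite \<Rightarrow> nat) \<Rightarrow> ('i \<Rightarrow>\<^sub>0 nat) \<Rightarrow> nat" where
  "weight n m = (\<Sum>i\<in>UNIV. Poly_Mapping.lookup m i * n i)"

definition max_length :: "('i::finite \<Rightarrow> nat) \<Rightarrow> nat \<Rightarrow> nat" where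
  "max_length n s = Max {total_deg m | m. weight n m = s}"

lemma weight_add: "weight n (a + b) = weight n a + weight n b"
  by (simp add: weight_def lookup_add sum.distrib distrib_right)

lemma total_deg_add: "total_deg (a + b) = total_deg a + total_deg b"
  by (simp add: total_deg_def lookup_add sum.distrib)

lemma weight_single: "weight n (Poly_Mapping.single i k) = k * n i"
  by (simp add: weight_def lookup_single when_def if_distrib[of "\<lambda>x. x * _"] cong: if_cong)

lemma total_deg_single: "total_deg (Poly_Mapping.single i k) = k"
  by (simp add: total_deg_def lookup_single when_def)

lemma coeff_curve_map:
  fixes n :: "'i::finite \<Rightarrow> nat" and f :: "('i, 'k::comm_ring_1) mpoly"
  shows "coeff (curve_map n f) s = coeff_sum (\<lambda>m. weight n m = s) f"
proof -
  have "(\<Prod>i\<in>I. Polynomial.monom (1::'k) (n i) ^ Poly_Mapping.lookup m i)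
      = Polynomial.monom 1 (\<Sum>i\<in>I. Poly_Mapping.lookup m i * n i)" if "finite I" for I and m :: "'i \<Rightarrow>\<^sub>0 nat"
    using that by (induction I rule: finite_induct) (simp_all add: monom_power mult_monom mult.commute)
  then have "curve_map n f = (\<Sum>m\<in>Poly_Mapping.keys f. Polynomial.monom (Poly_Mapping.lookup f m) (weight n m))"
    unfolding curve_map_def weight_def by (simp add: smult_monom)
  then show ?thesis
    by (simp add: coeff_sum_altdef[of "Poly_Mapping.keys f"] coeff_sum)
qed

lemma curve_ideal_iff: "f \<in> curve_ideal n \<longleftrightarrow> (\<forall>s. coeff_sum (\<lambda>m. weight n m = s) f = 0)"
  unfolding curve_ideal_def by (auto simp: poly_eq_iff coeff_curve_map)

lemma lookup_initial_form:
  "Poly_Mapping.lookup (initial_form f) m =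
    (if total_deg m = Min (total_deg ` Poly_Mapping.keys f) then Poly_Mapping.lookup f m else 0)"
  unfolding initial_form_def
  by (auto simp: lookup_sum lookup_single when_def not_in_keys_iff_lookup_eq_zero)

locale semigroup_gens =
  fixes n :: "'i::finite \<Rightarrow> nat"
  assumes gens_pos: "n i > 0"
begin

lemma total_deg_le_weight: "total_deg m \<le> weight n m"
  unfolding total_deg_def weight_def using gens_pos by (intro sum_mono) (simp add: Suc_leI)

lemma lengths_finite: "finite {total_deg m | m. weight n m = s}"
proof (rule finite_subset)
  show "{total_deg m | m. weight n m = s} \<subseteq> {..s}" using total_deg_le_weight by auto
qed simp

lemma total_deg_le_max_length: "total_deg m \<le> max_length n (weight n m)"
  unfolding max_length_def by (intro Max_ge lengths_finite) auto

lemma max_length_attained: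
  obtains m' where "weight n m' = weight n m" "total_deg m' = max_length n (weight n m)"
proof -
  have "max_length n (weight n m) \<in> {total_deg m' | m'. weight n m' = weight n m}"
    unfolding max_length_def by (intro Max_in lengths_finite) auto
  then show ?thesis using that by auto
qed

lemma max_length_superadditive:
  "max_length n (weight n a) + max_length n (weight n b) \<le> max_length n (weight n a + weight n b)"
proof -
  obtain a' where a: "weight n a' = weight n a" "total_deg a' = max_length n (weight n a)"
    by (rule max_length_attained)
  obtain b' where b: "weight n b' = weight n b" "total_deg b' = max_length n (weight n b)"
    by (rule max_length_attained)
  show ?thesis
    using total_deg_le_max_length[of "a' + b'"] by (simp add: a b weight_add total_deg_add)
qed

text \<open>The associated graded ring has a basis \<open>e\<^sub>s\<close> indexed by the semigroup: a monomial of weight \<open>s\<close>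
  maps to \<open>e\<^sub>s\<close> if it is a longest factorization of \<open>s\<close>, and to 0 otherwise. The coefficient of
  \<open>e\<^sub>s\<close> in the image of \<open>f\<close> is \<open>gr_coeff f s\<close>.\<close>
definition gr_coeff :: "('i, 'k::comm_ring_1) mpoly \<Rightarrow> nat \<Rightarrow> 'k" where
  "gr_coeff f s = coeff_sum (\<lambda>m. weight n m = s \<and> total_deg m = max_length n s) f"

definition gr_kernel :: "('i, 'k::comm_ring_1) mpoly set" where
  "gr_kernel = {f. \<forall>s. gr_coeff f s = 0}"

lemma gr_coeff_add: "gr_coeff (f + g) s = gr_coeff f s + gr_coeff g s"
  by (simp add: gr_coeff_def coeff_sum_add)

lemma gr_coeff_single:
  "gr_coeff (Poly_Mapping.single m c) s =
    (if weight n m = s \<and> total_deg m = max_length n s then c else 0)"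
  by (simp add: gr_coeff_def coeff_sum_single)

text \<open>Removing a factor \<open>u\<close> from a longest factorization leaves a longest factorization. Hence
  multiplication is \<open>e\<^sub>s e\<^sub>t = e\<^bsub>s+t\<^esub>\<close> if maximal lengths add up at \<open>s\<close> and \<open>t\<close>, and 0 otherwise.\<close>
lemma gr_coeff_monomial_mult:
  "gr_coeff (Poly_Mapping.single u c * f) (weight n u + s) =
    (if total_deg u + max_length n s = max_length n (weight n u + s) then c * gr_coeff f s else 0)"
proof -
  have eq: "gr_coeff (Poly_Mapping.single u c * f) (weight n u + s)
    = c * coeff_sum (\<lambda>m. weight n m = s \<and> total_deg u + total_deg m = max_length n (weight n u + s)) f"
    by (simp add: gr_coeff_def coeff_sum_monomial_mult weight_add total_deg_add)
  show ?thesis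
  proof (cases "total_deg u + max_length n s = max_length n (weight n u + s)")
    case True
    then have "coeff_sum (\<lambda>m. weight n m = s \<and> total_deg u + total_deg m = max_length n (weight n u + s)) f
      = gr_coeff f s" unfolding gr_coeff_def by (intro coeff_sum_cong) auto
    with eq True show ?thesis by simp
  next
    case False
    have "\<not> (weight n m = s \<and> total_deg u + total_deg m = max_length n (weight n u + s))" for m
    proof
      assume m: "weight n m = s \<and> total_deg u + total_deg m = max_length n (weight n u + s)"
      then show False
        using False max_length_superadditive[of u m] total_deg_le_max_length[of u]
          total_deg_le_max_length[of m] by auto
    qed
    then show ?thesis unfolding eq using False by (simp add: coeff_sum_False)
  qed
qed

lemma gr_coeff_monomial_mult_small:
  "s < weight n u \<Longrightarrow> gr_coeff (Poly_Mapping.single u c * f) s = 0"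
  unfolding gr_coeff_def coeff_sum_monomial_mult by (simp add: weight_add coeff_sum_False)

lemma gr_coeff_mult_zero:
  assumes "\<And>t. t \<le> s \<Longrightarrow> gr_coeff f t = 0"
  shows "gr_coeff (r * f) s = 0"
proof (induction r rule: mpoly_induct)
  case (single u c)
  show ?case
  proof (cases "weight n u \<le> s")
    case True
    then show ?thesis
      using gr_coeff_monomial_mult[of u c f "s - weight n u"] assms by simp
  qed (simp add: gr_coeff_monomial_mult_small)
qed (simp add: distrib_right gr_coeff_add)

lemma gr_kernel_ideal: "ideal (gr_kernel :: ('i, 'k::comm_ring_1) mpoly set) ring_of_type_algebra"
  unfolding type_ring_ideal_iff gr_kernel_def
  by (auto simp: gr_coeff_add gr_coeff_mult_zero) (simp add: gr_coeff_def coeff_sum_zero)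

text \<open>If \<open>d\<close> is the least degree in \<open>f\<close> and \<open>s\<close> has maximal length \<open>d\<close>, then all terms of weight \<open>s\<close>
  in \<open>f\<close> have degree \<open>d\<close>, and their coefficients cancel because \<open>f\<close> vanishes on the curve. For all
  other \<open>s\<close> the initial form has no longest factorization of \<open>s\<close>.\<close>
lemma initial_form_in_gr_kernel:
  assumes f: "f \<in> curve_ideal n"
  shows "initial_form f \<in> gr_kernel"
  unfolding gr_kernel_def mem_Collect_eq
proof
  fix s
  define d where "d = Min (total_deg ` Poly_Mapping.keys f)"
  have keys: "Poly_Mapping.keys (initial_form f) \<subseteq> Poly_Mapping.keys f"
    by (auto simp: in_keys_iff lookup_initial_form split: if_splits)
  have "gr_coeff (initial_form f) s =
      coeff_sum (\<lambda>m. (weight n m = s \<and> total_deg m = max_length n s) \<and> total_deg m = d) f"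
    unfolding gr_coeff_def coeff_sum_altdef[OF finite_keys keys]
      coeff_sum_altdef[of "Poly_Mapping.keys f" f, OF finite_keys order_refl]
    by (intro sum.cong) (auto simp: lookup_initial_form d_def)
  also have "\<dots> = 0"
  proof (cases "max_length n s = d")
    case True
    have "coeff_sum (\<lambda>m. (weight n m = s \<and> total_deg m = max_length n s) \<and> total_deg m = d) f
      = coeff_sum (\<lambda>m. weight n m = s) f"
    proof (rule coeff_sum_cong)
      fix m assume "m \<in> Poly_Mapping.keys f"
      then have "d \<le> total_deg m" unfolding d_def by (intro Min_le) auto
      then show "((weight n m = s \<and> total_deg m = max_length n s) \<and> total_deg m = d) \<longleftrightarrow> weight n m = s"
        using True total_deg_le_max_length[of m] by auto
    qed
    then show ?thesis using f unfolding curve_ideal_iff by simp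
  qed (simp add: coeff_sum_False)
  finally show "gr_coeff (initial_form f) s = 0" .
qed

lemma initial_form_binomial:
  fixes m m' :: "'i \<Rightarrow>\<^sub>0 nat"
  defines "b \<equiv> Poly_Mapping.single m 1 - Poly_Mapping.single m' (1 :: 'k::comm_ring_1)"
  assumes w: "weight n m = weight n m'" and ne: "m \<noteq> m'" and d: "total_deg m \<le> total_deg m'"
  shows "b \<in> curve_ideal n" "b \<noteq> 0"
    "initial_form b = (if total_deg m < total_deg m' then Poly_Mapping.single m 1 else b)"
proof -
  show "b \<in> curve_ideal n"
    unfolding curve_ideal_iff b_def using w by (simp add: coeff_sum_diff coeff_sum_single)
  have look: "Poly_Mapping.lookup b k = (if k = m then 1 else if k = m' then - 1 else 0)" for k
    unfolding b_def using ne by (auto simp: lookup_minus lookup_single when_def)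
  have keys: "Poly_Mapping.keys b = {m, m'}"
    by (auto simp: in_keys_iff look split: if_splits)
  then show "b \<noteq> 0" by auto
  have "Min (total_deg ` Poly_Mapping.keys b) = total_deg m" unfolding keys using d by simp
  then show "initial_form b = (if total_deg m < total_deg m' then Poly_Mapping.single m 1 else b)"
    using d ne by (intro poly_mapping_eqI) (auto simp: lookup_initial_form look lookup_single when_def)
qed

text \<open>A monomial that is not a longest factorization is the initial form of its difference with a
  longest one, and the difference of two longest factorizations of the same element is its own
  initial form. Modulo these, an element of the kernel reduces to a combination of one chosen
  longest factorization for each \<open>s\<close>, with coefficients \<open>gr_coeff f s = 0\<close>.\<close>
theorem initial_ideal_eq: "initial_ideal (curve_ideal n) = (gr_kernel :: ('i, 'k::comm_ring_1) mpoly set)"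
proof
  let ?A = "ring_of_type_algebra :: ('i, 'k) mpoly ring"
  let ?gens = "{initial_form f | f. f \<in> (curve_ideal n :: ('i, 'k) mpoly set) \<and> f \<noteq> 0}"
  let ?J = "initial_ideal (curve_ideal n) :: ('i, 'k) mpoly set"
  interpret ring ?A by (rule ring_from_type_algebra)
  show "?J \<subseteq> gr_kernel"
    unfolding initial_ideal_def
    using initial_form_in_gr_kernel by (intro genideal_minimal[OF gr_kernel_ideal]) auto
  have "ideal ?J ?A"
    unfolding initial_ideal_def by (intro genideal_ideal) (simp add: type_ring_simps)
  note J = type_ring_idealD[OF this]
  have gensJ: "initial_form f \<in> ?J" if "f \<in> curve_ideal n" "f \<noteq> 0" for f
    using genideal_self[of ?gens] that unfolding initial_ideal_def type_ring_simps by auto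
  have J_sum: "sum g M \<in> ?J" if "finite M" "\<And>m. m \<in> M \<Longrightarrow> g m \<in> ?J" for g and M :: "('i \<Rightarrow>\<^sub>0 nat) set"
    using that by (induction M rule: finite_induct) (auto intro: J)
  have short: "Poly_Mapping.single m c \<in> ?J" if m: "total_deg m < max_length n (weight n m)" for m and c :: 'k
  proof -
    obtain m' where m': "weight n m' = weight n m" "total_deg m' = max_length n (weight n m)"
      by (rule max_length_attained)
    have "m \<noteq> m'" "total_deg m \<le> total_deg m'" using m m'(2) by auto
    note b = initial_form_binomial[where ?'k = 'k, OF m'(1)[symmetric] this]
    have "Poly_Mapping.single m (1 :: 'k) \<in> ?J" using gensJ[OF b(1,2)] b(3) m m'(2) by simp
    from J(3)[OF this, of "Poly_Mapping.single 0 c"] show ?thesis by (simp add: mult_single)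
  qed
  have homog: "Poly_Mapping.single m c - Poly_Mapping.single m' c \<in> ?J"
    if m: "weight n m = weight n m'" "total_deg m = total_deg m'" for m m' and c :: 'k
  proof (cases "m = m'")
    case False
    then have "initial_form (Poly_Mapping.single m (1 :: 'k) - Poly_Mapping.single m' 1) \<in> ?J"
      using m by (intro gensJ initial_form_binomial) auto
    then have "Poly_Mapping.single m (1 :: 'k) - Poly_Mapping.single m' 1 \<in> ?J"
      using initial_form_binomial(3)[where ?'k = 'k, OF m(1) False] m(2) by simp
    from J(3)[OF this, of "Poly_Mapping.single 0 c"] show ?thesis
      by (simp add: mult_single right_diff_distrib)
  qed (simp add: J(1))
  show "gr_kernel \<subseteq> ?J"
  proof
    fix f :: "('i, 'k) mpoly" assume f: "f \<in> gr_kernel"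
    \<comment> \<open>the chosen longest factorization of \<open>s\<close>\<close>
    define M where "M = (\<lambda>s. SOME m. weight n m = s \<and> total_deg m = max_length n s)"
    have M: "weight n (M (weight n m)) = weight n m"
        "total_deg (M (weight n m)) = max_length n (weight n m)" for m
      using max_length_attained[of m] someI_ex[of "\<lambda>m'. weight n m' = weight n m \<and> total_deg m' = max_length n (weight n m)"]
      unfolding M_def by metis+
    define L where "L = (\<lambda>m. total_deg m = max_length n (weight n m))"
    define c where "c = Poly_Mapping.lookup f"
    \<comment> \<open>what remains of each term of \<open>f\<close> after reduction\<close>
    define g where "g = (\<lambda>m. if L m then Poly_Mapping.single (M (weight n m)) (c m) else 0)"
    have "(\<Sum>m\<in>Poly_Mapping.keys f. g m) = 0"
    proof (rule poly_mapping_eqI)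
      fix k
      have "Poly_Mapping.lookup (\<Sum>m\<in>Poly_Mapping.keys f. g m) k
        = (\<Sum>m\<in>Poly_Mapping.keys f. if L m \<and> M (weight n m) = k then c m else 0)"
        unfolding lookup_sum by (intro sum.cong) (auto simp: g_def lookup_single when_def)
      also have "\<dots> = coeff_sum (\<lambda>m. L m \<and> M (weight n m) = k) f"
        unfolding coeff_sum_altdef[OF finite_keys order_refl] c_def ..
      also have "\<dots> = 0"
      proof (cases "M (weight n k) = k")
        case True
        have "coeff_sum (\<lambda>m. L m \<and> M (weight n m) = k) f = gr_coeff f (weight n k)"
          unfolding gr_coeff_def by (intro coeff_sum_cong) (metis L_def M(1) True)
        then show ?thesis using f unfolding gr_kernel_def by simp
      next
        case False
        then show ?thesis by (intro coeff_sum_False) (metis M(1))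
      qed
      finally show "Poly_Mapping.lookup (\<Sum>m\<in>Poly_Mapping.keys f. g m) k = Poly_Mapping.lookup 0 k"
        by simp
    qed
    moreover have "f = (\<Sum>m\<in>Poly_Mapping.keys f. Poly_Mapping.single m (c m))"
      by (rule poly_mapping_eqI)
        (simp add: c_def lookup_sum lookup_single when_def not_in_keys_iff_lookup_eq_zero)
    ultimately have "f = (\<Sum>m\<in>Poly_Mapping.keys f. Poly_Mapping.single m (c m) - g m)"
      by (simp add: sum_subtractf)
    also have "\<dots> \<in> ?J"
    proof (rule J_sum)
      fix m
      show "Poly_Mapping.single m (c m) - g m \<in> ?J"
      proof (cases "L m")
        case True
        then show ?thesis unfolding g_def using homog[of m "M (weight n m)"] M[of m] by (simp add: L_def)
      next
        case False
        then show ?thesis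
          unfolding g_def using short[of m] total_deg_le_max_length[of m] by (simp add: L_def)
      qed
    qed simp
    finally show "f \<in> ?J" .
  qed
qed

end

section \<open>The tangent cone as a thickening of a line\<close>

definition line_hom :: "'i::finite \<Rightarrow> 'k::field poly \<Rightarrow> ('i, 'k) mpoly" where
  "line_hom j f = poly (map_poly (Poly_Mapping.single 0) f) (Poly_Mapping.single (Poly_Mapping.single j 1) 1)"

lemma line_hom_zero: "line_hom j 0 = 0"
  by (simp add: line_hom_def)

lemma line_hom_pCons:
  "line_hom j (pCons c f) =
    Poly_Mapping.single 0 c + Poly_Mapping.single (Poly_Mapping.single j 1) 1 * line_hom j f"
  by (simp add: line_hom_def map_poly_pCons)

lemma line_hom_add: "line_hom j (f + g) = line_hom j f + line_hom j g"
proof -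
  have "map_poly (Poly_Mapping.single 0) (f + g)
      = map_poly (Poly_Mapping.single 0) f + map_poly (Poly_Mapping.single (0 :: 'a \<Rightarrow>\<^sub>0 nat)) g"
    by (rule poly_eqI) (simp add: coeff_map_poly single_add)
  then show ?thesis by (simp add: line_hom_def)
qed

lemma line_hom_smult: "line_hom j (smult c f) = Poly_Mapping.single 0 c * line_hom j f"
  by (induction f) (simp_all add: line_hom_zero line_hom_pCons distrib_left mult_single mult.left_commute)

lemma line_hom_mult: "line_hom j (f * g) = line_hom j f * line_hom j g"
  by (induction f)
    (simp_all add: line_hom_zero line_hom_pCons line_hom_add line_hom_smult distrib_right mult.assoc)

lemma line_hom_one: "line_hom j 1 = 1"
  by (simp add: one_pCons line_hom_pCons line_hom_zero)

lemma line_hom_monom: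
  "line_hom j (Polynomial.monom c k) = Poly_Mapping.single (Poly_Mapping.single j k) c"
  by (induction k)
    (simp_all add: monom_0 monom_Suc line_hom_pCons line_hom_zero mult_single flip: single_add)

lemma lookup_line_hom:
  fixes j :: "'i::finite"
  shows "Poly_Mapping.lookup (line_hom j f) (Poly_Mapping.single j k) = coeff f k"
proof (induction f arbitrary: k)
  case (pCons c f)
  have "Poly_Mapping.lookup (Poly_Mapping.single (Poly_Mapping.single j 1) 1 * line_hom j f) (Poly_Mapping.single j k)
    = coeff_sum (\<lambda>m. Poly_Mapping.single j 1 + m = Poly_Mapping.single j k) (line_hom j f)"
    by (simp add: coeff_sum_eq_lookup[symmetric] coeff_sum_monomial_mult)
  also have "\<dots> = (case k of 0 \<Rightarrow> 0 | Suc k' \<Rightarrow> coeff f k')"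
  proof (cases k)
    case 0
    have "Poly_Mapping.single j 1 + m \<noteq> Poly_Mapping.single j 0" for m :: "'i \<Rightarrow>\<^sub>0 nat"
      by (auto simp: poly_mapping_eq_iff fun_eq_iff lookup_add lookup_single intro!: exI[of _ j])
    then show ?thesis using 0 by (simp add: coeff_sum_False)
  next
    case (Suc k')
    have "Poly_Mapping.single j 1 + m = Poly_Mapping.single j (Suc k') \<longleftrightarrow> m = Poly_Mapping.single j k'"
      for m :: "'i \<Rightarrow>\<^sub>0 nat"
      using add_left_cancel[of "Poly_Mapping.single j 1" m "Poly_Mapping.single j k'"]
      by (simp flip: single_add)
    then show ?thesis using Suc pCons.IH by (simp add: coeff_sum_eq_lookup)
  qed
  finally show ?case
    by (simp add: line_hom_pCons lookup_add lookup_single when_def coeff_pCons split: nat.splits)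
       (auto simp: poly_mapping_eq_iff fun_eq_iff lookup_single when_def)
qed (simp add: line_hom_zero)

text \<open>When one generator \<open>n j\<close> is strictly least, a factorization of length \<open>k\<close> has weight at least
  \<open>k * n j\<close>, with equality only for the power of the variable \<open>X\<^sub>j\<close>. So the powers of
  \<open>X\<^sub>j\<close> survive in the associated graded ring and are independent.\<close>
locale semigroup_least_gen = semigroup_gens n for n :: "'i::finite \<Rightarrow> nat" +
  fixes j :: 'i
  assumes least: "i \<noteq> j \<Longrightarrow> n j < n i"
begin

lemma total_deg_times_least_le: "total_deg m * n j \<le> weight n m"
  unfolding total_deg_def weight_def sum_distrib_right
  using least by (intro sum_mono mult_le_mono2) (metis le_less)

lemma total_deg_times_least_less:
  assumes "m \<noteq> Poly_Mapping.single j (total_deg m)"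
  shows "total_deg m * n j < weight n m"
proof -
  have "\<exists>i. i \<noteq> j \<and> Poly_Mapping.lookup m i > 0"
  proof (rule ccontr)
    assume "\<not> ?thesis"
    then have z: "Poly_Mapping.lookup m i = 0" if "i \<noteq> j" for i using that by auto
    then have "total_deg m = Poly_Mapping.lookup m j"
      unfolding total_deg_def by (subst sum.remove[of _ j]) (auto intro!: sum.neutral)
    then have "m = Poly_Mapping.single j (total_deg m)"
      using z by (intro poly_mapping_eqI) (auto simp: lookup_single when_def)
    with assms show False ..
  qed
  then obtain i where "i \<noteq> j" "Poly_Mapping.lookup m i > 0" by auto
  then show ?thesis
    unfolding total_deg_def weight_def sum_distrib_right
    using least by (intro sum_strict_mono_ex1) (auto intro!: bexI[of _ i] mult_le_mono2, metis le_less)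
qed

lemma max_length_least_multiple: "max_length n (k * n j) = k"
proof -
  obtain m where m: "weight n m = k * n j" "total_deg m = max_length n (k * n j)"
    using max_length_attained[of "Poly_Mapping.single j k"] unfolding weight_single by auto
  have "max_length n (k * n j) * n j \<le> k * n j" using total_deg_times_least_le[of m] m by simp
  moreover have "k \<le> max_length n (k * n j)"
    using total_deg_le_max_length[of "Poly_Mapping.single j k"] by (simp add: weight_single total_deg_single)
  ultimately show ?thesis using gens_pos[of j] by simp
qed

lemma gr_coeff_line: "gr_coeff f (k * n j) = Poly_Mapping.lookup f (Poly_Mapping.single j k)"
  unfolding gr_coeff_def coeff_sum_eq_lookup[symmetric]
proof (rule coeff_sum_cong)
  fix m
  show "weight n m = k * n j \<and> total_deg m = max_length n (k * n j) \<longleftrightarrow> m = Poly_Mapping.single j k"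
    using total_deg_times_least_less[of m]
    by (metis less_irrefl max_length_least_multiple weight_single total_deg_single)
qed

lemma monomial_power:
  fixes c :: "'k::comm_ring_1"
  shows "\<exists>m'. Poly_Mapping.single m c ^ k = Poly_Mapping.single m' (c ^ k) \<and>
    weight n m' = k * weight n m \<and> total_deg m' = k * total_deg m"
proof (induction k)
  case 0
  show ?case by (intro exI[of _ 0]) (simp add: weight_def total_deg_def)
next
  case (Suc k)
  then obtain m' where "Poly_Mapping.single m c ^ k = Poly_Mapping.single m' (c ^ k)"
    "weight n m' = k * weight n m" "total_deg m' = k * total_deg m" by auto
  then show ?case by (intro exI[of _ "m + m'"]) (simp add: mult_single weight_add total_deg_add)
qed

text \<open>If the weight of \<open>m\<close> exceeds \<open>n j\<close> times its length, then \<open>n j\<close> copies of \<open>m\<close> form a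
  factorization that is shorter than the one by \<open>weight n m\<close> copies of \<open>n j\<close>.\<close>
lemma monomial_nilpotent:
  fixes c :: "'k::comm_ring_1"
  assumes "m \<noteq> Poly_Mapping.single j (total_deg m)"
  shows "Poly_Mapping.single m c ^ n j \<in> gr_kernel"
proof -
  obtain m' where m': "Poly_Mapping.single m c ^ n j = Poly_Mapping.single m' (c ^ n j)"
    "weight n m' = n j * weight n m" "total_deg m' = n j * total_deg m" using monomial_power by blast
  have "total_deg m' < weight n m"
    using total_deg_times_least_less[OF assms] m'(3) by (simp add: mult.commute)
  then have "total_deg m' \<noteq> max_length n (weight n m')"
    using max_length_least_multiple[of "weight n m"] m'(2) by (simp add: mult.commute)
  then show ?thesis unfolding m'(1) gr_kernel_def by (auto simp: gr_coeff_single)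
qed

sublocale gr: line_thickening "gr_kernel :: ('i, 'k::field) mpoly set" "line_hom j"
proof (intro line_thickening.intro type_ideal.intro line_thickening_axioms.intro gr_kernel_ideal)
  note K = type_ring_idealD[OF gr_kernel_ideal[where ?'k = 'k]]
  fix f g :: "'k poly" and a :: "('i, 'k) mpoly"
  show "line_hom j (f + g) = line_hom j f + line_hom j g" by (rule line_hom_add)
  show "line_hom j (f * g) = line_hom j f * line_hom j g" by (rule line_hom_mult)
  show "line_hom j (1 :: 'k poly) = 1" by (rule line_hom_one)
  show "f = 0" if "line_hom j f \<in> gr_kernel"
  proof (rule poly_eqI)
    fix k
    have "gr_coeff (line_hom j f) (k * n j) = 0" using that unfolding gr_kernel_def by simp
    then show "coeff f k = coeff 0 k" unfolding gr_coeff_line lookup_line_hom by simp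
  qed
  show "\<exists>f k. (a - line_hom j f) ^ k \<in> gr_kernel"
  proof (induction a rule: mpoly_induct)
    case (single m c)
    show ?case
    proof (cases "m = Poly_Mapping.single j (total_deg m)")
      case True
      then have "(Poly_Mapping.single m c - line_hom j (Polynomial.monom c (total_deg m))) ^ 1 \<in> gr_kernel"
        using K(1) by (simp add: line_hom_monom)
      then show ?thesis by blast
    next
      case False
      have "(Poly_Mapping.single m c - line_hom j 0) ^ n j \<in> gr_kernel"
        using monomial_nilpotent[OF False] by (simp add: line_hom_zero)
      then show ?thesis by blast
    qed
  next
    case (add a b)
    then obtain f k g l where "(a - line_hom j f) ^ k \<in> gr_kernel" "(b - line_hom j g) ^ l \<in> gr_kernel"
      by auto
    then have "((a - line_hom j f) + (b - line_hom j g)) ^ (k + l) \<in> gr_kernel"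
      using nilpotents_add[where J = gr_kernel and a = "a - line_hom j f" and b = "b - line_hom j g"] K by metis
    then have "(a + b - line_hom j (f + g)) ^ (k + l) \<in> gr_kernel"
      by (simp add: line_hom_add algebra_simps)
    then show ?case by blast
  qed
  \<comment> \<open>induction on the weight: the lowest component of a product with \<open>f\<close> is multiplied by its constant term\<close>
  show "a \<in> gr_kernel" if f: "coeff f 0 \<noteq> 0" "line_hom j f * a \<in> gr_kernel"
  proof -
    obtain c g where f_eq: "f = pCons c g" by (cases f)
    have c: "c \<noteq> 0" using f(1) f_eq by simp
    have "gr_coeff a s = 0" for s
    proof (induction s rule: less_induct)
      case (less s)
      have "gr_coeff (Poly_Mapping.single (Poly_Mapping.single j 1) 1 * (line_hom j g * a)) s = 0"
      proof (cases "n j \<le> s")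
        case True
        have "gr_coeff (line_hom j g * a) (s - n j) = 0"
          using less gens_pos[of j] True by (intro gr_coeff_mult_zero) simp
        then show ?thesis
          using gr_coeff_monomial_mult[of "Poly_Mapping.single j 1" 1 "line_hom j g * a" "s - n j"] True
          by (simp add: weight_single)
      qed (simp add: gr_coeff_monomial_mult_small weight_single)
      moreover have "gr_coeff (Poly_Mapping.single 0 c * a) s = c * gr_coeff a s"
        using gr_coeff_monomial_mult[of 0 c a s] by (simp add: weight_def total_deg_def)
      moreover have "gr_coeff (line_hom j f * a) s = 0" using f(2) unfolding gr_kernel_def by simp
      ultimately show ?case
        using c by (simp add: f_eq line_hom_pCons distrib_right gr_coeff_add mult.assoc)
    qed
    then show ?thesis unfolding gr_kernel_def by simp
  qed
qed

text \<open>Multiplication by \<open>X\<^sub>j\<close> sends \<open>e\<^sub>s\<close> either to the basis element of \<open>s + n j\<close> or to 0. It is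
  injective when the latter never happens, and the following says just that.\<close>
definition additive_length :: bool where
  "additive_length \<longleftrightarrow> (\<forall>m. max_length n (weight n m + n j) = max_length n (weight n m) + 1)"

lemma param_regular_iff:
  "gr.regular (line_hom j (Polynomial.monom (1 :: 'k::field) 1)) \<longleftrightarrow> additive_length"
proof
  let ?X = "Poly_Mapping.single (Poly_Mapping.single j 1) (1 :: 'k)"
  assume reg: "gr.regular (line_hom j (Polynomial.monom (1 :: 'k) 1))"
  show additive_length
    unfolding additive_length_def
  proof (intro allI, rule ccontr)
    fix m
    assume ne: "max_length n (weight n m + n j) \<noteq> max_length n (weight n m) + 1"
    obtain m' where m': "weight n m' = weight n m" "total_deg m' = max_length n (weight n m)"
      by (rule max_length_attained)
    let ?a = "Poly_Mapping.single m' (1 :: 'k)"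
    have "?X * ?a \<in> gr_kernel"
      using ne m' unfolding gr_kernel_def
      by (auto simp: mult_single gr_coeff_single weight_add total_deg_add weight_single
        total_deg_single add.commute)
    then have "?a \<in> gr_kernel" using reg unfolding gr.regular_def line_hom_monom by blast
    then have "gr_coeff ?a (weight n m) = 0" unfolding gr_kernel_def by simp
    then show False using m' by (simp add: gr_coeff_single)
  qed
next
  let ?X = "Poly_Mapping.single (Poly_Mapping.single j 1) (1 :: 'k)"
  assume add: additive_length
  show "gr.regular (line_hom j (Polynomial.monom (1 :: 'k) 1))"
    unfolding gr.regular_def line_hom_monom
  proof (intro allI impI)
    fix a :: "('i, 'k) mpoly" assume a: "?X * a \<in> gr_kernel"
    have "gr_coeff a s = 0" for s
    proof (cases "\<exists>m. weight n m = s")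
      case True
      then obtain m where m: "weight n m = s" by blast
      have "1 + max_length n s = max_length n (n j + s)"
        using add m unfolding additive_length_def by (auto simp: add.commute)
      then have "gr_coeff (?X * a) (n j + s) = gr_coeff a s"
        using gr_coeff_monomial_mult[of "Poly_Mapping.single j 1" 1 a s]
        by (simp add: weight_single total_deg_single)
      then show ?thesis using a unfolding gr_kernel_def by simp
    qed (simp add: gr_coeff_def coeff_sum_False)
    then show "a \<in> gr_kernel" unfolding gr_kernel_def by simp
  qed
qed

theorem tangent_cone_cohen_macaulay_iff:
  "cohen_macaulay (tangent_cone_ring (curve_ideal n :: ('i, 'k::field) mpoly set)) \<longleftrightarrow> additive_length"
  unfolding tangent_cone_ring_def initial_ideal_eq
  using gr.cohen_macaulay_iff_param_regular param_regular_iff by blast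

end

section \<open>Normal forms with respect to the relations of Komeda\<close>

text \<open>The relations between Komeda's generators, in terms of \<open>p = \<alpha>\<^sub>2 - 1\<close>, \<open>q = \<alpha>\<^sub>3 - 1\<close>,
  \<open>c = \<alpha>\<^sub>4 - 1\<close>, \<open>b = \<alpha>\<^sub>2\<^sub>1\<close>, \<open>d = \<alpha>\<^sub>1 - \<alpha>\<^sub>2\<^sub>1 - 1\<close>. They correspond to binomials in
  the ideal of the curve. Read from left to right, each of them trades a monomial in
  \<open>X\<^sub>2, X\<^sub>3, X\<^sub>4\<close> for one divisible by \<open>X\<^sub>1\<close>.\<close>
locale komeda_relations =
  fixes N1 N2 N3 N4 b c d p q :: nat
  assumes pos: "0 < b" "0 < c" "0 < d" "0 < p" "0 < q"
    and N1: "N1 = (p + 1) * (q + 1) * c + 1"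
    and rel1: "N3 + c * N4 = (b + d + 1) * N1"
    and rel2: "(p + 1) * N2 = b * N1 + N4"
    and rel3: "(q + 1) * N3 = d * N1 + N2"
    and rel4: "(c + 1) * N4 = N1 + p * N2 + q * N3"
    and rel5: "N2 + c * N4 = (b + 1) * N1 + q * N3"
    and coprime: "gcd N1 (gcd N2 (gcd N3 N4)) = 1"
begin

fun val :: "nat \<times> nat \<times> nat \<Rightarrow> nat" where
  "val (x, y, z) = x * N2 + y * N3 + z * N4"

fun len :: "nat \<times> nat \<times> nat \<Rightarrow> nat" where
  "len (x, y, z) = x + y + z"

text \<open>The exponents of the monomials in \<open>X\<^sub>2, X\<^sub>3, X\<^sub>4\<close> to which no relation applies.\<close>
definition standard :: "(nat \<times> nat \<times> nat) set" where
  "standard = insert (0, 0, c) ({..p} \<times> {..q} \<times> {..<c})"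

text \<open>No relation, read from left to right, shortens a factorization. Only the second, third and fourth
  relation impose a condition; the bounds \<open>c \<le> b + d\<close> and \<open>c \<le> b + q\<close> that belong to the first and
  the fifth follow.\<close>
definition balanced :: bool where
  "balanced \<longleftrightarrow> p \<le> b \<and> q \<le> d \<and> c \<le> p + q"

lemma N1_pos: "0 < N1"
  unfolding N1 by simp

lemma finite_standard: "finite standard"
  unfolding standard_def by simp

lemma card_standard: "card standard = N1"
  unfolding standard_def N1 by (subst card_insert_disjoint) (auto simp: card_cartesian_product algebra_simps)

lemma reduction_step:
  assumes "t \<notin> standard"
  shows "\<exists>k t'. 0 < k \<and> val t = k * N1 + val t' \<and> (balanced \<longrightarrow> len t \<le> k + len t')"
proof -
  obtain x y z where t: "t = (x, y, z)" by (cases t)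
  consider "p + 1 \<le> x" | "q + 1 \<le> y" | "c + 1 \<le> z" | "1 \<le> x" "c \<le> z" | "1 \<le> y" "c \<le> z"
    using assms unfolding t standard_def by fastforce
  then show ?thesis
  proof cases
    case 1
    then obtain x' where x: "x = (p + 1) + x'" by (metis le_Suc_ex)
    have "val t = b * N1 + val (x', y, z + 1)"
      unfolding t x using rel2 by (simp add: algebra_simps)
    then show ?thesis
      using pos by (intro exI[of _ b] exI[of _ "(x', y, z + 1)"]) (simp add: t x balanced_def)
  next
    case 2
    then obtain y' where y: "y = (q + 1) + y'" by (metis le_Suc_ex)
    have "val t = d * N1 + val (x + 1, y', z)"
      unfolding t y using rel3 by (simp add: algebra_simps)
    then show ?thesis
      using pos by (intro exI[of _ d] exI[of _ "(x + 1, y', z)"]) (simp add: t y balanced_def)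
  next
    case 3
    then obtain z' where z: "z = (c + 1) + z'" by (metis le_Suc_ex)
    have "val t = 1 * N1 + val (x + p, y + q, z')"
      unfolding t z using rel4 by (simp add: algebra_simps)
    then show ?thesis
      by (intro exI[of _ 1] exI[of _ "(x + p, y + q, z')"]) (simp add: t z balanced_def)
  next
    case 4
    then obtain x' z' where xz: "x = 1 + x'" "z = c + z'" by (metis le_Suc_ex)
    have "val t = (b + 1) * N1 + val (x', y + q, z')"
      unfolding t xz using rel5 by (simp add: algebra_simps)
    then show ?thesis
      by (intro exI[of _ "b + 1"] exI[of _ "(x', y + q, z')"]) (simp add: t xz balanced_def)
  next
    case 5
    then obtain y' z' where yz: "y = 1 + y'" "z = c + z'" by (metis le_Suc_ex)
    have "val t = (b + d + 1) * N1 + val (x, y', z')"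
      unfolding t yz using rel1 by (simp add: algebra_simps)
    then show ?thesis
      by (intro exI[of _ "b + d + 1"] exI[of _ "(x, y', z')"]) (simp add: t yz balanced_def)
  qed
qed

text \<open>Rewriting terminates because every step lowers the value of the part in \<open>X\<^sub>2, X\<^sub>3, X\<^sub>4\<close> by a
  positive multiple of \<open>N1\<close>.\<close>
lemma reduce:
  "\<exists>k. \<exists>t'\<in>standard. val t = k * N1 + val t' \<and> (k = 0 \<longrightarrow> t' = t) \<and>
    (balanced \<longrightarrow> len t \<le> k + len t')"
proof (induction "val t" arbitrary: t rule: less_induct)
  case less
  show ?case
  proof (cases "t \<in> standard")
    case True
    then show ?thesis by (intro exI[of _ 0] bexI[of _ t]) simp_all
  next
    case False
    then obtain k t1 where t1: "0 < k" "val t = k * N1 + val t1" "balanced \<longrightarrow> len t \<le> k + len t1"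
      using reduction_step by blast
    have "val t1 < val t" using t1(1,2) N1_pos by simp
    from less[OF this] obtain k' t' where t': "t' \<in> standard" "val t1 = k' * N1 + val t'"
      "balanced \<longrightarrow> len t1 \<le> k' + len t'" by blast
    then show ?thesis
      using t1 by (intro exI[of _ "k + k'"] bexI[of _ t']) (auto simp: algebra_simps)
  qed
qed

text \<open>The Bezout coefficients become nonnegative by reducing them modulo \<open>N1\<close>.\<close>
lemma residue_attained:
  assumes "r < N1"
  shows "\<exists>t. val t mod N1 = r"
proof -
  define g where "g = gcd N3 N4"
  obtain w3 w4 where w34: "w3 * int N3 + w4 * int N4 = int g"
    using bezout_int[of "int N3" "int N4"] unfolding g_def by auto
  obtain w2 u where w2: "w2 * int N2 + u * int g = int (gcd N2 g)"
    using bezout_int[of "int N2" "int g"] by auto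
  obtain w1 v where "w1 * int N1 + v * int (gcd N2 g) = int (gcd N1 (gcd N2 g))"
    using bezout_int[of "int N1" "int (gcd N2 g)"] by auto
  then have "w1 * int N1 + v * int (gcd N2 g) = 1" using coprime unfolding g_def by simp
  then have one: "w1 * int N1 + v * (w2 * int N2 + u * (w3 * int N3 + w4 * int N4)) = 1"
    unfolding w34 w2 .
  define x where "x = nat ((int r * (v * w2)) mod int N1)"
  define y where "y = nat ((int r * (v * u * w3)) mod int N1)"
  define z where "z = nat ((int r * (v * u * w4)) mod int N1)"
  have xyz: "int x = (int r * (v * w2)) mod int N1" "int y = (int r * (v * u * w3)) mod int N1"
    "int z = (int r * (v * u * w4)) mod int N1"
    unfolding x_def y_def z_def using N1_pos by simp_all
  have "int (val (x, y, z)) mod int N1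
      = (int r * (v * w2) * int N2 + int r * (v * u * w3) * int N3 + int r * (v * u * w4) * int N4) mod int N1"
    unfolding val.simps of_nat_add of_nat_mult xyz by (intro mod_add_cong mod_mult_cong) simp_all
  also have "\<dots> = (int r - int r * w1 * int N1) mod int N1"
  proof -
    have "int r * (v * w2) * int N2 + int r * (v * u * w3) * int N3 + int r * (v * u * w4) * int N4
      = int r * (w1 * int N1 + v * (w2 * int N2 + u * (w3 * int N3 + w4 * int N4))) - int r * w1 * int N1"
      by (simp add: algebra_simps)
    then show ?thesis unfolding one by simp
  qed
  also have "\<dots> = int r mod int N1" by (metis diff_add_cancel mod_mult_self2 mult.commute)
  finally have "val (x, y, z) mod N1 = r mod N1" by (metis of_nat_eq_iff of_nat_mod)
  then show ?thesis using assms by auto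
qed

text \<open>There are exactly \<open>N1\<close> standard exponents, and by reduction they reach all \<open>N1\<close> residues; a
  surjection between sets of the same finite size is injective. This makes normal forms unique.\<close>
lemma val_mod_inj: "inj_on (\<lambda>t. val t mod N1) standard"
proof (rule eq_card_imp_inj_on[OF finite_standard])
  have "{..<N1} \<subseteq> (\<lambda>t. val t mod N1) ` standard"
  proof
    fix r assume "r \<in> {..<N1}"
    then obtain t where t: "val t mod N1 = r" using residue_attained by blast
    obtain k t' where "t' \<in> standard" "val t = k * N1 + val t'" using reduce by blast
    with t show "r \<in> (\<lambda>t. val t mod N1) ` standard" by force
  qed
  moreover have "(\<lambda>t. val t mod N1) ` standard \<subseteq> {..<N1}" using N1_pos by auto
  ultimately have "(\<lambda>t. val t mod N1) ` standard = {..<N1}" by (intro subset_antisym)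
  then show "card ((\<lambda>t. val t mod N1) ` standard) = card standard" by (simp add: card_standard)
qed

lemma normal_form_unique:
  assumes "t \<in> standard" "t' \<in> standard" "k * N1 + val t = k' * N1 + val t'"
  shows "t = t'" "k = k'"
proof -
  have "val t mod N1 = (k * N1 + val t) mod N1" by simp
  also have "\<dots> = val t' mod N1" unfolding assms(3) by simp
  finally show "t = t'" using val_mod_inj assms(1,2) by (auto dest: inj_onD)
  with assms(3) N1_pos show "k = k'" by simp
qed

end

locale komeda_curve = semigroup_least_gen n 1 + komeda_relations "n 1" "n 2" "n 3" "n 4" b c d p q
  for n :: "4 \<Rightarrow> nat" and b c d p q
begin

definition tail :: "(4 \<Rightarrow>\<^sub>0 nat) \<Rightarrow> nat \<times> nat \<times> nat" where
  "tail m = (Poly_Mapping.lookup m 2, Poly_Mapping.lookup m 3, Poly_Mapping.lookup m 4)"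

lemma weight_tail: "weight n m = Poly_Mapping.lookup m 1 * n 1 + val (tail m)"
  by (simp add: weight_def sum_4 tail_def)

lemma total_deg_tail: "total_deg m = Poly_Mapping.lookup m 1 + len (tail m)"
  by (simp add: total_deg_def sum_4 tail_def)

fun mon :: "nat \<Rightarrow> nat \<times> nat \<times> nat \<Rightarrow> (4 \<Rightarrow>\<^sub>0 nat)" where
  "mon k (x, y, z) = Poly_Mapping.single 1 k + Poly_Mapping.single 2 x + Poly_Mapping.single 3 y
    + Poly_Mapping.single 4 z"

lemma weight_mon: "weight n (mon k t) = k * n 1 + val t"
  by (cases t) (simp add: weight_add weight_single)

lemma total_deg_mon: "total_deg (mon k t) = k + len t"
  by (cases t) (simp add: total_deg_add total_deg_single)

text \<open>Any other factorization reduces to a normal form with a positive power of \<open>X\<^sub>1\<close>, so a standard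
  value has just one factorization.\<close>
lemma max_length_standard:
  assumes "t \<in> standard"
  shows "max_length n (val t) = len t"
proof -
  obtain m where m: "weight n m = weight n (mon 0 t)" "total_deg m = max_length n (weight n (mon 0 t))"
    by (rule max_length_attained)
  obtain k t' where t': "t' \<in> standard" "val (tail m) = k * n 1 + val t'" "k = 0 \<longrightarrow> t' = tail m"
    using reduce by blast
  have "(Poly_Mapping.lookup m 1 + k) * n 1 + val t' = 0 * n 1 + val t"
    using m(1) t'(2) by (simp add: weight_tail[of m] weight_mon algebra_simps)
  from normal_form_unique[OF t'(1) assms this] have "t' = t" "Poly_Mapping.lookup m 1 = 0" "k = 0" by auto
  then have "total_deg m = len t" using t'(3) by (simp add: total_deg_tail)
  then show ?thesis using m(2) by (simp add: weight_mon)
qed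

text \<open>If lengths are additive, normal forms are longest factorizations, and comparing both sides of the
  second, third and fourth relation, whose right-hand sides are normal forms, gives the three
  inequalities. If the relations never shorten a factorization, every longest factorization can
  be replaced by the normal form, and the normal forms of \<open>s\<close> and \<open>s + n 1\<close> differ by one factor
  \<open>X\<^sub>1\<close>.\<close>
theorem additive_length_iff_balanced: "additive_length \<longleftrightarrow> balanced"
proof
  assume add: additive_length
  have L: "max_length n (k * n 1 + val t) = k + len t" if t: "t \<in> standard" for k t
  proof (induction k)
    case 0
    then show ?case using max_length_standard[OF t] by simp
  next
    case (Suc k)
    have "max_length n (weight n (mon k t) + n 1) = max_length n (weight n (mon k t)) + 1"
      using add unfolding additive_length_def by blast
    then show ?case using Suc by (simp add: weight_mon algebra_simps)
  qed
  have bound: "k + len u \<le> k' + len t" if "t \<in> standard" "k * n 1 + val u = k' * n 1 + val t" for k k' u t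
    using total_deg_le_max_length[of "mon k u"] L[OF that(1), of k'] that(2)
    by (simp add: weight_mon total_deg_mon)
  have "(0, 0, 1) \<in> standard" unfolding standard_def using pos by (cases "c = 1") auto
  then have "p + 1 \<le> b + 1"
    using bound[of "(0, 0, 1)" 0 "(p + 1, 0, 0)" b] rel2 by simp
  moreover have "q + 1 \<le> d + 1"
    using bound[of "(1, 0, 0)" 0 "(0, q + 1, 0)" d] rel3 pos by (auto simp: standard_def)
  moreover have "c + 1 \<le> 1 + (p + q)"
    using bound[of "(p, q, 0)" 0 "(0, 0, c + 1)" 1] rel4 pos by (auto simp: standard_def)
  ultimately show balanced unfolding balanced_def by simp
next
  assume bal: balanced
  show additive_length
    unfolding additive_length_def
  proof
    fix m
    obtain k t where t: "t \<in> standard" "val (tail m) = k * n 1 + val t" using reduce by blast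
    obtain m' where m': "weight n m' = weight n (m + Poly_Mapping.single 1 1)"
      "total_deg m' = max_length n (weight n (m + Poly_Mapping.single 1 1))" by (rule max_length_attained)
    obtain k' t' where t': "t' \<in> standard" "val (tail m') = k' * n 1 + val t'"
      "len (tail m') \<le> k' + len t'" using reduce[of "tail m'"] bal by blast
    let ?e = "Poly_Mapping.lookup m 1 + k" and ?e' = "Poly_Mapping.lookup m' 1 + k'"
    have "?e' * n 1 + val t' = (?e + 1) * n 1 + val t"
      using m'(1) t(2) t'(2) by (simp add: weight_tail[of m] weight_tail[of m'] weight_add weight_single algebra_simps)
    note eq = normal_form_unique[OF t'(1) t(1) this]
    have w: "weight n (mon ?e t) = weight n m"
      using t(2) by (simp add: weight_mon weight_tail[of m] algebra_simps)
    have "total_deg m' \<le> ?e' + len t'" using t'(3) by (simp add: total_deg_tail)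
    also have "\<dots> = total_deg (mon ?e t) + 1" unfolding eq by (simp add: total_deg_mon)
    also have "\<dots> \<le> max_length n (weight n m) + 1"
      using total_deg_le_max_length[of "mon ?e t"] by (simp add: w)
    finally have "max_length n (weight n m + n 1) \<le> max_length n (weight n m) + 1"
      using m'(2) by (simp add: weight_add weight_single)
    moreover have "max_length n (weight n m) + 1 \<le> max_length n (weight n m + n 1)"
      using max_length_superadditive[of m "Poly_Mapping.single 1 1"] max_length_least_multiple[of 1]
      by (simp add: weight_single)
    ultimately show "max_length n (weight n m + n 1) = max_length n (weight n m) + 1" by simp
  qed
qed

end

section \<open>Minimality of the generators\<close>

lemma minimal_gens_irredundant:
  assumes "minimal_gens n" "n i = (\<Sum>k\<in>UNIV - {i}. u k * n k)"
  shows False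
proof -
  have "gen_semigroup n (UNIV - {i}) = gen_semigroup n UNIV"
  proof
    show "gen_semigroup n (UNIV - {i}) \<subseteq> gen_semigroup n UNIV"
    proof
      fix s assume "s \<in> gen_semigroup n (UNIV - {i})"
      then obtain v where "s = (\<Sum>k\<in>UNIV - {i}. v k * n k)" unfolding gen_semigroup_def by auto
      also have "\<dots> = (\<Sum>k\<in>UNIV. (if k = i then 0 else v k) * n k)"
        by (subst sum.remove[of UNIV i]) (auto intro!: sum.cong)
      finally show "s \<in> gen_semigroup n UNIV" unfolding gen_semigroup_def by auto
    qed
    show "gen_semigroup n UNIV \<subseteq> gen_semigroup n (UNIV - {i})"
    proof
      fix s assume "s \<in> gen_semigroup n UNIV"
      then obtain v where "s = (\<Sum>k\<in>UNIV. v k * n k)" unfolding gen_semigroup_def by auto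
      also have "\<dots> = v i * n i + (\<Sum>k\<in>UNIV - {i}. v k * n k)" by (subst sum.remove[of UNIV i]) auto
      also have "\<dots> = (\<Sum>k\<in>UNIV - {i}. (v i * u k + v k) * n k)"
        unfolding assms(2) by (simp add: sum_distrib_left sum.distrib distrib_right mult.assoc)
      finally show "s \<in> gen_semigroup n (UNIV - {i})" unfolding gen_semigroup_def by auto
    qed
  qed
  then show False using assms(1) unfolding minimal_gens_def by blast
qed

lemma minimal_gens_no_multiple:
  assumes "minimal_gens n" "i \<noteq> j"
  shows "n i \<noteq> k * n j"
proof
  assume "n i = k * n j"
  also have "\<dots> = (\<Sum>l\<in>UNIV - {i}. (if l = j then k else 0) * n l)"
    using assms(2) by (simp add: if_distrib[of "\<lambda>x. x * _"] cong: if_cong)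
  finally show False by (rule minimal_gens_irredundant[OF assms(1)])
qed

theorem theorem3p5:
  fixes n :: "4 \<Rightarrow> nat" and \<alpha>1 \<alpha>2 \<alpha>3 \<alpha>4 \<alpha>21 :: int
  assumes "\<forall>i. n i > 0"
    and "Gcd (range n) = 1"
    and "minimal_gens n"
    and "pseudo_symmetric (gen_semigroup n UNIV)"
    and "defining_integers n \<alpha>1 \<alpha>2 \<alpha>3 \<alpha>4 \<alpha>21"
    and "\<forall>i. n 1 \<le> n i"
  shows "cohen_macaulay (tangent_cone_ring (curve_ideal n :: (4, 'k::field) mpoly set)) \<longleftrightarrow>
         \<alpha>2 \<le> \<alpha>21 + 1 \<and> \<alpha>21 + \<alpha>3 \<le> \<alpha>1 \<and> \<alpha>4 \<le> \<alpha>2 + \<alpha>3 - 1"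
proof -
  define b where "b = nat \<alpha>21"
  define c where "c = nat (\<alpha>4 - 1)"
  define d where "d = nat (\<alpha>1 - \<alpha>21 - 1)"
  define p where "p = nat (\<alpha>2 - 1)"
  define q where "q = nat (\<alpha>3 - 1)"
  note di = assms(5)[unfolded defining_integers_def]
  have \<alpha>: "\<alpha>21 = int b" "\<alpha>4 = int c + 1" "\<alpha>1 = int b + int d + 1" "\<alpha>2 = int p + 1" "\<alpha>3 = int q + 1"
    using di unfolding b_def c_def d_def p_def q_def by auto
  have pos: "0 < b" "0 < c" "0 < p" "0 < q" using di unfolding \<alpha> by auto
  have gens: "int (n 1) = (int p + 1) * (int q + 1) * int c + 1"
    "int (n 2) = int b * (int q + 1) * (int c + 1) + int d * int q + (int q + 1)"
    "int (n 3) = (int b + int d + 1) * (int c + 1) + int d * int p * int c - (int c + 1) + 1"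
    "int (n 4) = (int b + int d + 1) * (int p + 1) * int q + int b * int p + (int p + 1)"
    using di unfolding \<alpha> by simp_all
  have nat_eq: "x = y" if "int x = int y" for x y using that by simp
  have rel3: "(q + 1) * n 3 = d * n 1 + n 2"
    by (rule nat_eq) (simp add: gens algebra_simps)
  \<comment> \<open>otherwise the third relation makes \<open>n 2\<close> a multiple of \<open>n 3\<close>, against minimality\<close>
  have "d \<noteq> 0"
  proof
    assume "d = 0"
    with rel3 have "n 2 = (q + 1) * n 3" by simp
    then show False using minimal_gens_no_multiple[OF assms(3), of 2 3 "q + 1"] by simp
  qed
  have least: "n 1 < n i" if "i \<noteq> 1" for i
    using minimal_gens_no_multiple[OF assms(3) that, of 1] assms(6) by (simp add: order.not_eq_order_implies_strict)
  interpret komeda_curve n b c d p q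
  proof
    show "0 < d" using \<open>d \<noteq> 0\<close> by simp
    show "n 1 = (p + 1) * (q + 1) * c + 1" by (rule nat_eq) (simp add: gens algebra_simps)
    show "n 3 + c * n 4 = (b + d + 1) * n 1" by (rule nat_eq) (simp add: gens algebra_simps)
    show "(p + 1) * n 2 = b * n 1 + n 4" by (rule nat_eq) (simp add: gens algebra_simps)
    show "(c + 1) * n 4 = n 1 + p * n 2 + q * n 3" by (rule nat_eq) (simp add: gens algebra_simps)
    show "n 2 + c * n 4 = (b + 1) * n 1 + q * n 3" by (rule nat_eq) (simp add: gens algebra_simps)
    have "range n = {n 1, n 2, n 3, n 4}" unfolding UNIV_4 by simp
    then show "gcd (n 1) (gcd (n 2) (gcd (n 3) (n 4))) = 1" using assms(2) by simp
  qed (use assms(1) pos rel3 least in auto)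
  have "balanced \<longleftrightarrow> \<alpha>2 \<le> \<alpha>21 + 1 \<and> \<alpha>21 + \<alpha>3 \<le> \<alpha>1 \<and> \<alpha>4 \<le> \<alpha>2 + \<alpha>3 - 1"
    unfolding balanced_def \<alpha> by auto
  then show ?thesis
    using tangent_cone_cohen_macaulay_iff[where ?'k = 'k] additive_length_iff_balanced by simp
qed

end
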